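(* In the synchronous semantics, the model-checking problem for $\exists^\ast\forall^\ast$-\textsf{HyperMTL} is undecidable, and the model-checking problem for $\forall^\ast\exists^\ast$-\textsf{HyperMTL} is undecidable. That is, there is no algorithm that, given a timed automaton $\mathcal{A}$ over $\Sigma_{AP}$ and a closed \textsf{HyperMTL} formula $\phi$ over $AP$ whose quantifier prefix is a block of existential quantifiers followed by a block of universal quantifiers (resp. universal followed by existential), decides whether $[\![\mathcal{A}]\!]\models^{\mathit{sync}}\phi$.
   Context: Fix a finite set $AP$ of atomic propositions and let $\Sigma_{AP}=2^{AP}$. A timed word (trace) over a finite alphabet $\Sigma$ is a finite sequence $\rho=(\sigma_1,\tau_1)\cdots(\sigma_n,\tau_n)$ with $\sigma_i\in\Sigma$, $\tau_i\in\mathbb{R}_{\ge 0}$ and $\tau_1<\dots<\tau_n$; write $t\in\rho$ iff $t=\tau_i$ for some $i$, and then $\rho(t)=\sigma_i$. $T\Sigma^\ast$ is the set of all timed words over $\Sigma$. A timed automaton (TA) over $\Sigma$ is $\langle\Sigma,S,s_0,X,\Delta,F\rangle$ with finite set of locations $S$, initial location $s_0$, finite set of clocks $X$, transitions $\Delta\subseteq S\times\Sigma\times G(X)\times2^X\times S$ and accepting locations $F\subseteq S$, where guards are generated by $g::=\top\mid g\wedge g\mid x\bowtie c$ with $\bowtie\in\{\le,<,\ge,>\}$, $x\in X$, $c\in\mathbb{N}$. A run on $(\sigma_1,\tau_1)\cdots(\sigma_n,\tau_n)$ is $(s_0,v_0)\cdots(s_n,v_n)$ with $v_0\equiv0$ and,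 for each $i<n$, a transition $(s_i,\sigma_{i+1},g,\lambda,s_{i+1})$ with $v_i+(\tau_{i+1}-\tau_i)\models g$ ($\tau_0=0$) and $v_{i+1}=(v_i+(\tau_{i+1}-\tau_i))[\lambda\leftarrow0]$; it is accepting if $s_n\in F$. $[\![\mathcal{A}]\!]$ is the set of timed words with an accepting run. \textsf{HyperMTL} syntax: with an infinite set $V$ of trace variables, formulae are $\phi::=\exists\pi\,\phi\mid\forall\pi\,\phi\mid\psi$ and $\psi::=\top\mid\top_\pi\mid p_\pi\mid\psi_1\wedge\psi_2\mid\neg\psi\mid\psi_1\,\mathbf{U}_I\,\psi_2\mid\psi_1\,\mathbf{S}_I\,\psi_2$, where $\pi\in V$, $p\in AP$, and $I\subseteq\mathbb{R}_{\ge0}$ is a non-singular interval with endpoints in $\mathbb{N}\cup\{\infty\}$; each quantifier binds a fresh variable; closed means no free trace variables. Derived: $\bot=\neg\top$, $\vee$, $\psi_1\widetilde{\mathbf{U}}_I\psi_2=\neg((\neg\psi_1)\mathbf{U}_I(\neg\psi_2))$, $\psi_1\widetilde{\mathbf{S}}_I\psi_2=\neg((\neg\psi_1)\mathbf{S}_I(\neg\psi_2))$. Asynchronous satisfaction: for $T\subseteq T\Sigma_{AP}^\ast$, a partial map $\Pi:V\to T\Sigma_{AP}^\ast$ and $t\ge0$: $(T,t)\models_\Pi\top$ iff $t\in\rho$ for some $\rho$ in the range of $\Pi$ ($\bot$ iff not); $\top_\pi$ iff $t\in\Pi(\pi)$ (its negation iff $t\notin\Pi(\pi)$); $p_\pi$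 iff $t\in\Pi(\pi)$ and $p\in\Pi(\pi)(t)$; $\neg p_\pi$ iff $t\in\Pi(\pi)$ and $p\notin\Pi(\pi)(t)$; $\wedge,\vee$ as usual; $\psi_1\mathbf{U}_I\psi_2$ at $t$ iff there is $t'>t$ with $t'-t\in I$, $\top$ and $\psi_2$ holding at $t'$, and $\psi_1$ holding at every $t''\in(t,t')$ at which $\top$ holds; $\psi_1\widetilde{\mathbf{U}}_I\psi_2$ at $t$ iff for every $t'>t$ with $t'-t\in I$ at which $\top$ holds, $\psi_2$ holds at $t'$ or $\psi_1$ holds at some $t''\in(t,t')$ at which $\top$ holds; $\mathbf{S}_I,\widetilde{\mathbf{S}}_I$ are the past mirrors; $\neg\psi$ is evaluated as the negation normal form of $\neg\psi$; $\exists\pi\,\phi$ iff $(T,t)\models_{\Pi[\pi\mapsto\rho]}\phi$ for some $\rho\in T$; $\forall\pi\,\phi$ iff for all $\rho\in T$. Synchronous semantics $\models^{\mathit{sync}}$: the same clauses, except that each quantifier ranges only over those $\rho\in T$ whose set of timestamps equals the set of timestamps of every trace already in the range of $\Pi$; $T\models^{\mathit{sync}}\phi$ iff $(T,0)\models^{\mathit{sync}}_{\Pi_\emptyset}\phi$.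
   Formalization: The set AP of atomic propositions is assumed nonempty; for empty AP all synchronously quantified traces coincide and the problem reduces to single-trace MITL with past, which is decidable. *)

theory Defs
  imports Complex_Main "HOL-Library.Nat_Bijection"
begin

section \<open>Timed words and timed automata\<close>

type_synonym 'a tword = "('a \<times> real) list"

definition timed_words :: "'a set \<Rightarrow> 'a tword set" where
  "timed_words \<Sigma> = {\<rho>. fst ` set \<rho> \<subseteq> \<Sigma> \<and> (\<forall>t \<in> snd ` set \<rho>. 0 \<le> t)
     \<and> sorted_wrt (<) (map snd \<rho>)}"

definition timestamps :: "'a tword \<Rightarrow> real set" where
  "timestamps \<rho> = snd ` set \<rho>"

text \<open>Meaningful only for \<open>t \<in> timestamps \<rho>\<close>; the letter is then unique, as timestamps strictly increase.\<close>

definition letter_at :: "'a tword \<Rightarrow> real \<Rightarrow> 'a" where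
  "letter_at \<rho> t = (THE \<sigma>. (\<sigma>, t) \<in> set \<rho>)"

datatype cmp = Le | Lt | Ge | Gt

datatype 'x guard = GTrue | GAnd "'x guard" "'x guard" | GCmp 'x cmp nat

primrec cmp_sat :: "cmp \<Rightarrow> real \<Rightarrow> real \<Rightarrow> bool" where
  "cmp_sat Le a b = (a \<le> b)"
| "cmp_sat Lt a b = (a < b)"
| "cmp_sat Ge a b = (a \<ge> b)"
| "cmp_sat Gt a b = (a > b)"

primrec guard_sat :: "('x \<Rightarrow> real) \<Rightarrow> 'x guard \<Rightarrow> bool" where
  "guard_sat v GTrue = True"
| "guard_sat v (GAnd g h) = (guard_sat v g \<and> guard_sat v h)"
| "guard_sat v (GCmp x op c) = cmp_sat op (v x) (real c)"

record ('a, 's, 'x) ta =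
  locs :: "'s set"
  init :: 's
  clocks :: "'x set"
  trans :: "('s \<times> 'a \<times> 'x guard \<times> 'x set \<times> 's) set"
  final :: "'s set"

text \<open>The set of guards is infinite, so finiteness of the transition relation is required explicitly.\<close>

definition timed_automaton :: "'a set \<Rightarrow> ('a, 's, 'x) ta \<Rightarrow> bool" where
  "timed_automaton \<Sigma> A \<longleftrightarrow>
     finite (locs A) \<and> init A \<in> locs A \<and> finite (clocks A) \<and> finite (trans A)
   \<and> trans A \<subseteq> locs A \<times> \<Sigma> \<times> {g. set_guard g \<subseteq> clocks A} \<times> Pow (clocks A) \<times> locs A
   \<and> final A \<subseteq> locs A"

text \<open>Only the entries \<open>0, \<dots>, length \<rho>\<close> of the sequences \<open>s\<close> and \<open>v\<close> are constrained.\<close>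

definition is_run ::
  "('a, 's, 'x) ta \<Rightarrow> 'a tword \<Rightarrow> (nat \<Rightarrow> 's) \<Rightarrow> (nat \<Rightarrow> 'x \<Rightarrow> real) \<Rightarrow> bool" where
  "is_run A \<rho> s v \<longleftrightarrow> s 0 = init A \<and> (\<forall>x. v 0 x = 0) \<and>
     (\<forall>i < length \<rho>. \<exists>g r. (s i, fst (\<rho> ! i), g, r, s (Suc i)) \<in> trans A \<and>
        (let d = snd (\<rho> ! i) - (if i = 0 then 0 else snd (\<rho> ! (i - 1)));
             u = (\<lambda>x. v i x + d)
         in guard_sat u g \<and> v (Suc i) = (\<lambda>x. if x \<in> r then 0 else u x)))"

definition ta_lang :: "'a set \<Rightarrow> ('a, 's, 'x) ta \<Rightarrow> 'a tword set" where
  "ta_lang \<Sigma> A = {\<rho> \<in> timed_words \<Sigma>. \<exists>s v. is_run A \<rho> s v \<and> s (length \<rho>) \<in> final A}"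

section \<open>HyperMTL\<close>

text \<open>Atomic propositions and trace variables are natural numbers.
  \<open>Bnd lc a b rc\<close> has endpoints \<open>a\<close> and \<open>b\<close>, \<open>Unbnd lc a\<close> has endpoints \<open>a\<close> and \<open>\<infinity>\<close>;
  the flags tell whether the left and right endpoints belong to the interval.\<close>

datatype intvl = Bnd bool nat nat bool | Unbnd bool nat

primrec intvl_set :: "intvl \<Rightarrow> real set" where
  "intvl_set (Bnd lc a b rc) =
     {x. (if lc then real a \<le> x else real a < x) \<and> (if rc then x \<le> real b else x < real b)}"
| "intvl_set (Unbnd lc a) = {x. if lc then real a \<le> x else real a < x}"

primrec nonsingular :: "intvl \<Rightarrow> bool" where
  "nonsingular (Bnd lc a b rc) = (a < b)"
| "nonsingular (Unbnd lc a) = True"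

datatype mtl =
    Top
  | TopV nat
  | PropV nat nat  \<comment> \<open>\<open>PropV p \<pi>\<close> is the proposition \<open>p\<close> on trace \<open>\<pi>\<close>\<close>
  | And mtl mtl
  | Neg mtl
  | Until mtl intvl mtl
  | Since mtl intvl mtl

datatype hypermtl = Ex nat hypermtl | All nat hypermtl | QF mtl

text \<open>Negation normal forms; \<open>NDUntil\<close> and \<open>NDSince\<close> are the duals of until and since.\<close>

datatype nnf =
    NTop | NBot
  | NTopV nat | NNotTopV nat
  | NPropV nat nat | NNotPropV nat nat
  | NAnd nnf nnf | NOr nnf nnf
  | NUntil nnf intvl nnf | NDUntil nnf intvl nnf
  | NSince nnf intvl nnf | NDSince nnf intvl nnf

text \<open>\<open>to_nnf True \<psi>\<close> is the negation normal form of \<open>\<psi>\<close>, and \<open>to_nnf False \<psi>\<close> that of \<open>Neg \<psi>\<close>.\<close>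

primrec to_nnf :: "bool \<Rightarrow> mtl \<Rightarrow> nnf" where
  "to_nnf b Top = (if b then NTop else NBot)"
| "to_nnf b (TopV x) = (if b then NTopV x else NNotTopV x)"
| "to_nnf b (PropV p x) = (if b then NPropV p x else NNotPropV p x)"
| "to_nnf b (And \<psi>1 \<psi>2) = (if b then NAnd else NOr) (to_nnf b \<psi>1) (to_nnf b \<psi>2)"
| "to_nnf b (Neg \<psi>) = to_nnf (\<not> b) \<psi>"
| "to_nnf b (Until \<psi>1 I \<psi>2) = (if b then NUntil else NDUntil) (to_nnf b \<psi>1) I (to_nnf b \<psi>2)"
| "to_nnf b (Since \<psi>1 I \<psi>2) = (if b then NSince else NDSince) (to_nnf b \<psi>1) I (to_nnf b \<psi>2)"

type_synonym assignment = "nat \<Rightarrow> nat set tword option"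

definition event_at :: "assignment \<Rightarrow> real \<Rightarrow> bool" where
  "event_at \<Pi> t \<longleftrightarrow> (\<exists>\<rho> \<in> ran \<Pi>. t \<in> timestamps \<rho>)"

text \<open>The truth value of a literal on an unassigned variable is immaterial for closed formulas;
  here it is false.\<close>

primrec nnf_sat :: "assignment \<Rightarrow> real \<Rightarrow> nnf \<Rightarrow> bool" where
  "nnf_sat \<Pi> t NTop = event_at \<Pi> t"
| "nnf_sat \<Pi> t NBot = (\<not> event_at \<Pi> t)"
| "nnf_sat \<Pi> t (NTopV x) = (\<exists>\<rho>. \<Pi> x = Some \<rho> \<and> t \<in> timestamps \<rho>)"
| "nnf_sat \<Pi> t (NNotTopV x) = (\<exists>\<rho>. \<Pi> x = Some \<rho> \<and> t \<notin> timestamps \<rho>)"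
| "nnf_sat \<Pi> t (NPropV p x) =
     (\<exists>\<rho>. \<Pi> x = Some \<rho> \<and> t \<in> timestamps \<rho> \<and> p \<in> letter_at \<rho> t)"
| "nnf_sat \<Pi> t (NNotPropV p x) =
     (\<exists>\<rho>. \<Pi> x = Some \<rho> \<and> t \<in> timestamps \<rho> \<and> p \<notin> letter_at \<rho> t)"
| "nnf_sat \<Pi> t (NAnd \<psi>1 \<psi>2) = (nnf_sat \<Pi> t \<psi>1 \<and> nnf_sat \<Pi> t \<psi>2)"
| "nnf_sat \<Pi> t (NOr \<psi>1 \<psi>2) = (nnf_sat \<Pi> t \<psi>1 \<or> nnf_sat \<Pi> t \<psi>2)"
| "nnf_sat \<Pi> t (NUntil \<psi>1 I \<psi>2) =
     (\<exists>t' > t. t' - t \<in> intvl_set I \<and> event_at \<Pi> t' \<and> nnf_sat \<Pi> t' \<psi>2 \<and>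
        (\<forall>t'' \<in> {t<..<t'}. event_at \<Pi> t'' \<longrightarrow> nnf_sat \<Pi> t'' \<psi>1))"
| "nnf_sat \<Pi> t (NDUntil \<psi>1 I \<psi>2) =
     (\<forall>t' > t. t' - t \<in> intvl_set I \<and> event_at \<Pi> t' \<longrightarrow> nnf_sat \<Pi> t' \<psi>2 \<or>
        (\<exists>t'' \<in> {t<..<t'}. event_at \<Pi> t'' \<and> nnf_sat \<Pi> t'' \<psi>1))"
| "nnf_sat \<Pi> t (NSince \<psi>1 I \<psi>2) =
     (\<exists>t' < t. t - t' \<in> intvl_set I \<and> event_at \<Pi> t' \<and> nnf_sat \<Pi> t' \<psi>2 \<and>
        (\<forall>t'' \<in> {t'<..<t}. event_at \<Pi> t'' \<longrightarrow> nnf_sat \<Pi> t'' \<psi>1))"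
| "nnf_sat \<Pi> t (NDSince \<psi>1 I \<psi>2) =
     (\<forall>t' < t. t - t' \<in> intvl_set I \<and> event_at \<Pi> t' \<longrightarrow> nnf_sat \<Pi> t' \<psi>2 \<or>
        (\<exists>t'' \<in> {t'<..<t}. event_at \<Pi> t'' \<and> nnf_sat \<Pi> t'' \<psi>1))"

primrec sync_sat :: "nat set tword set \<Rightarrow> assignment \<Rightarrow> real \<Rightarrow> hypermtl \<Rightarrow> bool" where
  "sync_sat T \<Pi> t (QF \<psi>) = nnf_sat \<Pi> t (to_nnf True \<psi>)"
| "sync_sat T \<Pi> t (Ex x \<phi>) =
     (\<exists>\<rho> \<in> T. (\<forall>\<rho>' \<in> ran \<Pi>. timestamps \<rho> = timestamps \<rho>') \<and> sync_sat T (\<Pi>(x \<mapsto> \<rho>)) t \<phi>)"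
| "sync_sat T \<Pi> t (All x \<phi>) =
     (\<forall>\<rho> \<in> T. (\<forall>\<rho>' \<in> ran \<Pi>. timestamps \<rho> = timestamps \<rho>') \<longrightarrow> sync_sat T (\<Pi>(x \<mapsto> \<rho>)) t \<phi>)"

definition sync_models :: "nat set tword set \<Rightarrow> hypermtl \<Rightarrow> bool" where
  "sync_models T \<phi> \<longleftrightarrow> sync_sat T Map.empty 0 \<phi>"

primrec mtl_over :: "nat set \<Rightarrow> mtl \<Rightarrow> bool" where
  "mtl_over AP Top = True"
| "mtl_over AP (TopV x) = True"
| "mtl_over AP (PropV p x) = (p \<in> AP)"
| "mtl_over AP (And \<psi>1 \<psi>2) = (mtl_over AP \<psi>1 \<and> mtl_over AP \<psi>2)"
| "mtl_over AP (Neg \<psi>) = mtl_over AP \<psi>"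
| "mtl_over AP (Until \<psi>1 I \<psi>2) = (mtl_over AP \<psi>1 \<and> nonsingular I \<and> mtl_over AP \<psi>2)"
| "mtl_over AP (Since \<psi>1 I \<psi>2) = (mtl_over AP \<psi>1 \<and> nonsingular I \<and> mtl_over AP \<psi>2)"

primrec mtl_vars :: "mtl \<Rightarrow> nat set" where
  "mtl_vars Top = {}"
| "mtl_vars (TopV x) = {x}"
| "mtl_vars (PropV p x) = {x}"
| "mtl_vars (And \<psi>1 \<psi>2) = mtl_vars \<psi>1 \<union> mtl_vars \<psi>2"
| "mtl_vars (Neg \<psi>) = mtl_vars \<psi>"
| "mtl_vars (Until \<psi>1 I \<psi>2) = mtl_vars \<psi>1 \<union> mtl_vars \<psi>2"
| "mtl_vars (Since \<psi>1 I \<psi>2) = mtl_vars \<psi>1 \<union> mtl_vars \<psi>2"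

primrec matrix :: "hypermtl \<Rightarrow> mtl" where
  "matrix (Ex x \<phi>) = matrix \<phi>"
| "matrix (All x \<phi>) = matrix \<phi>"
| "matrix (QF \<psi>) = \<psi>"

primrec binders :: "hypermtl \<Rightarrow> nat list" where
  "binders (Ex x \<phi>) = x # binders \<phi>"
| "binders (All x \<phi>) = x # binders \<phi>"
| "binders (QF \<psi>) = []"

primrec free_vars :: "hypermtl \<Rightarrow> nat set" where
  "free_vars (Ex x \<phi>) = free_vars \<phi> - {x}"
| "free_vars (All x \<phi>) = free_vars \<phi> - {x}"
| "free_vars (QF \<psi>) = mtl_vars \<psi>"

definition closed_hypermtl :: "nat set \<Rightarrow> hypermtl \<Rightarrow> bool" where
  "closed_hypermtl AP \<phi> \<longleftrightarrow>
     mtl_over AP (matrix \<phi>) \<and> distinct (binders \<phi>) \<and> free_vars \<phi> = {}"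

text \<open>Quantifier blocks may be empty.\<close>

primrec all_block :: "hypermtl \<Rightarrow> bool" where
  "all_block (Ex x \<phi>) = False"
| "all_block (All x \<phi>) = all_block \<phi>"
| "all_block (QF \<psi>) = True"

primrec ex_block :: "hypermtl \<Rightarrow> bool" where
  "ex_block (Ex x \<phi>) = ex_block \<phi>"
| "ex_block (All x \<phi>) = False"
| "ex_block (QF \<psi>) = True"

primrec exists_forall :: "hypermtl \<Rightarrow> bool" where
  "exists_forall (Ex x \<phi>) = exists_forall \<phi>"
| "exists_forall (All x \<phi>) = all_block \<phi>"
| "exists_forall (QF \<psi>) = True"

primrec forall_exists :: "hypermtl \<Rightarrow> bool" where
  "forall_exists (Ex x \<phi>) = ex_block \<phi>"
| "forall_exists (All x \<phi>) = forall_exists \<phi>"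
| "forall_exists (QF \<psi>) = True"

section \<open>Algorithms\<close>

text \<open>Kleene's partial recursive functions, interpreted as partial functions on argument lists.
  \<open>PrimRec f g\<close> and \<open>Minim f\<close> recurse and minimise on the first argument.\<close>

datatype recf =
    Zero
  | Succ
  | Proj nat
  | Comp recf "recf list"
  | PrimRec recf recf
  | Minim recf

primrec rec_eval :: "recf \<Rightarrow> nat list \<Rightarrow> nat option" where
  "rec_eval Zero xs = Some 0"
| "rec_eval Succ xs = (case xs of [] \<Rightarrow> None | x # _ \<Rightarrow> Some (Suc x))"
| "rec_eval (Proj i) xs = (if i < length xs then Some (xs ! i) else None)"
| "rec_eval (Comp f gs) xs =
     (let ys = map (\<lambda>g. rec_eval g xs) gs
      in if None \<in> set ys then None else rec_eval f (map the ys))"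
| "rec_eval (PrimRec f g) xs =
     (case xs of [] \<Rightarrow> None
      | n # ys \<Rightarrow> rec_nat (rec_eval f ys)
          (\<lambda>k r. case r of None \<Rightarrow> None | Some v \<Rightarrow> rec_eval g (k # v # ys)) n)"
| "rec_eval (Minim f) xs =
     (if \<exists>y. rec_eval f (y # xs) = Some 0 \<and> (\<forall>i < y. rec_eval f (i # xs) \<noteq> None)
      then Some (LEAST y. rec_eval f (y # xs) = Some 0) else None)"

text \<open>A decision problem consists of a set of instances, their encoding as numbers, and the set of
  yes-instances. Nothing is required of a decider on numbers that do not encode an instance.\<close>

definition decidable :: "('i \<Rightarrow> nat) \<Rightarrow> 'i set \<Rightarrow> ('i \<Rightarrow> bool) \<Rightarrow> bool" where
  "decidable code D P \<longleftrightarrow>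
     (\<exists>f. \<forall>x \<in> D. rec_eval f [code x] = Some (if P x then 1 else 0))"

primrec cmp_code :: "cmp \<Rightarrow> nat" where
  "cmp_code Le = 0"
| "cmp_code Lt = 1"
| "cmp_code Ge = 2"
| "cmp_code Gt = 3"

primrec guard_code :: "nat guard \<Rightarrow> nat" where
  "guard_code GTrue = list_encode [0]"
| "guard_code (GAnd g h) = list_encode [1, guard_code g, guard_code h]"
| "guard_code (GCmp x op c) = list_encode [2, x, cmp_code op, c]"

text \<open>\<^const>\<open>set_encode\<close> is injective on finite sets, which is all that is needed for the letters,
  location sets, clock sets and transition sets of a timed automaton over a finite alphabet.\<close>

fun trans_code :: "nat \<times> nat set \<times> nat guard \<times> nat set \<times> nat \<Rightarrow> nat" where
  "trans_code (s, a, g, r, s') =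
     list_encode [s, set_encode a, guard_code g, set_encode r, s']"

definition ta_code :: "(nat set, nat, nat) ta \<Rightarrow> nat" where
  "ta_code A = list_encode
     [set_encode (locs A), init A, set_encode (clocks A),
      set_encode (trans_code ` trans A), set_encode (final A)]"

primrec intvl_code :: "intvl \<Rightarrow> nat" where
  "intvl_code (Bnd lc a b rc) = list_encode [0, of_bool lc, a, b, of_bool rc]"
| "intvl_code (Unbnd lc a) = list_encode [1, of_bool lc, a]"

primrec mtl_code :: "mtl \<Rightarrow> nat" where
  "mtl_code Top = list_encode [0]"
| "mtl_code (TopV x) = list_encode [1, x]"
| "mtl_code (PropV p x) = list_encode [2, p, x]"
| "mtl_code (And \<psi>1 \<psi>2) = list_encode [3, mtl_code \<psi>1, mtl_code \<psi>2]"
| "mtl_code (Neg \<psi>) = list_encode [4, mtl_code \<psi>]"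
| "mtl_code (Until \<psi>1 I \<psi>2) = list_encode [5, mtl_code \<psi>1, intvl_code I, mtl_code \<psi>2]"
| "mtl_code (Since \<psi>1 I \<psi>2) = list_encode [6, mtl_code \<psi>1, intvl_code I, mtl_code \<psi>2]"

primrec hypermtl_code :: "hypermtl \<Rightarrow> nat" where
  "hypermtl_code (Ex x \<phi>) = list_encode [0, x, hypermtl_code \<phi>]"
| "hypermtl_code (All x \<phi>) = list_encode [1, x, hypermtl_code \<phi>]"
| "hypermtl_code (QF \<psi>) = list_encode [2, mtl_code \<psi>]"

type_synonym mc_instance = "(nat set, nat, nat) ta \<times> hypermtl"

definition mc_instances :: "nat set \<Rightarrow> (hypermtl \<Rightarrow> bool) \<Rightarrow> mc_instance set" where
  "mc_instances AP frag =
     {(A, \<phi>). timed_automaton (Pow AP) A \<and> closed_hypermtl AP \<phi> \<and> frag \<phi>}"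

fun mc_code :: "mc_instance \<Rightarrow> nat" where
  "mc_code (A, \<phi>) = list_encode [ta_code A, hypermtl_code \<phi>]"

text \<open>\<open>AP\<close> is a fixed parameter, not part of the instance. For empty \<open>AP\<close> all traces quantified
  synchronously coincide, and the problem collapses to that of single-trace MITL with past, which is
  decidable; undecidability results therefore have to assume \<open>AP \<noteq> {}\<close>.\<close>

definition sync_mc_decidable :: "nat set \<Rightarrow> (hypermtl \<Rightarrow> bool) \<Rightarrow> bool" where
  "sync_mc_decidable AP frag \<longleftrightarrow>
     decidable mc_code (mc_instances AP frag)
       (\<lambda>(A, \<phi>). sync_models (ta_lang (Pow AP) A) \<phi>)"

end

theory Submission
  imports Defs
begin

text \<open>
  The automaton can be taken to accept all timed words. Synchronous quantification over all timed
  words is then existential and universal monadic second-order quantification over a common finite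
  set of timestamps. The computation of a recursive function is a finite derivation in a Horn
  program; its steps are laid out as rows of length 1 of a grid whose columns represent the natural
  numbers, a number being kept in place from row to row by distance exactly 1. Punctuality, which
  the intervals do not provide, comes from the universal traces: if a set has an element within
  distance at most 1 but none within distance less than 1, then it has one at distance exactly 1.

  A decider \<open>f\<close> is refuted by diagonalisation: the function that, given the code of a formula, halts
  iff \<open>f\<close> rejects the formula applied to this code is expressed by some formula,
  which \<open>f\<close> misjudges when it is applied to its own code. Negation turns \<open>\<exists>\<^sup>*\<forall>\<^sup>*\<close> into
  \<open>\<forall>\<^sup>*\<exists>\<^sup>*\<close>.
\<close>

section \<open>Recursive functions on codes\<close>

text \<open>Horn clauses suit the grid because a derivation consists of positive facts only:
  divergence is mere underivability, and a row is correct as soon as the facts in its rule body are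
  heads of rows later in time, which is well-founded in a finite word. A fact may be used
  arbitrarily many rows before the row that establishes it, so positions in distant rows must be
  compared. To this end \<open>tr_col i\<close> is assumed to meet an event for variable
  \<open>i\<close> and to advance by exactly 1, and the premises are required under this assumption.
  For soundness the universal trace is instantiated with the true column; for completeness, every
  set that meets the assumption contains the true column, and the premises are monotone in it.

  Earlier rows may lack events that later rows have, so a position gets its number only by
  projection to the last row, where zero, successor and the inputs are tested. The inputs are
  numerals counted out by nested \<open>nxt\<close>; since they are conjoined to a fixed matrix, the
  formula can speak about the code of that matrix without circularity.\<close>

primrec rconst :: "nat \<Rightarrow> recf" where
  "rconst 0 = Zero"
| "rconst (Suc n) = Comp Succ [rconst n]"

lemma rec_eval_rconst [simp]: "rec_eval (rconst n) xs = Some n"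
  by (induction n) auto

definition radd :: recf where
  "radd = PrimRec (Proj 0) (Comp Succ [Proj 1])"

lemma rec_eval_radd [simp]: "rec_eval radd [m, n] = Some (m + n)"
  unfolding radd_def by (induction m) auto

definition rtri :: recf where
  "rtri = PrimRec Zero (Comp Succ [Comp radd [Proj 0, Proj 1]])"

lemma rec_eval_rtri [simp]: "rec_eval rtri [n] = Some (triangle n)"
  unfolding rtri_def by (induction n) auto

definition rpair :: recf where
  "rpair = Comp radd [Comp rtri [radd], Proj 0]"

lemma rec_eval_rpair [simp]: "rec_eval rpair [m, n] = Some (prod_encode (m, n))"
  by (simp add: rpair_def prod_encode_def)

primrec rlist :: "recf list \<Rightarrow> recf" where
  "rlist [] = Zero"
| "rlist (g # gs) = Comp Succ [Comp rpair [g, rlist gs]]"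

lemma rec_eval_rlist:
  "list_all2 (\<lambda>g v. rec_eval g xs = Some v) gs vs \<Longrightarrow>
   rec_eval (rlist gs) xs = Some (list_encode vs)"
  by (induction rule: list_all2_induct) auto

definition riszero :: recf where
  "riszero = PrimRec (Comp Succ [Zero]) Zero"

lemma rec_eval_riszero [simp]: "rec_eval riszero [n] = Some (of_bool (n = 0))"
proof (induction n)
  case (Suc n)
  then have "rec_eval riszero [Suc n] = rec_eval Zero [n, of_bool (n = 0)]"
    unfolding riszero_def by (simp only: rec_eval.simps list.case nat.rec option.case)
  then show ?case by simp
qed (simp add: riszero_def)

section \<open>Recursive functions as Horn programs\<close>

text \<open>Arithmetic is confined to \<open>inputs\<close>, equating a variable with a numbered
  input, and \<open>succs\<close>, because these are the relations between columns that a formula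
  can check directly in the last row. Zero is the input numbered 0.\<close>

datatype 'p rule = Rule (head_sym: 'p) (head_args: "nat list")
  (inputs: "(nat \<times> nat) list") (succs: "(nat \<times> nat) list") (body: "('p \<times> nat list) list")

inductive derivable :: "'p rule list \<Rightarrow> (nat \<Rightarrow> nat) \<Rightarrow> 'p \<Rightarrow> nat list \<Rightarrow> bool"
  for P :: "'p rule list" and \<nu> :: "nat \<Rightarrow> nat" where
  derivableI: "\<lbrakk>R \<in> set P; \<forall>(a, i) \<in> set (inputs R). \<sigma> i = \<nu> a;
     \<forall>(i, j) \<in> set (succs R). \<sigma> j = Suc (\<sigma> i);
     \<forall>(q, zs) \<in> set (body R). derivable P \<nu> q (map \<sigma> zs)\<rbrakk>
   \<Longrightarrow> derivable P \<nu> (head_sym R) (map \<sigma> (head_args R))"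

datatype sym = Fn recf | MinAux recf | Goal

text \<open>Facts are graphs: arguments followed by the value. Variables below the arity
  \<open>k\<close> are the arguments, \<open>k\<close> is the value (for a projection the argument
  itself is repeated, for minimisation and \<open>MinAux\<close> it is also the search bound), and
  larger ones are intermediate results. The arity is a parameter because a \<open>recf\<close> does
  not determine it. \<open>MinAux f\<close> replaces the bounded universal condition of minimisation
  by a recursion on the bound.\<close>

primrec horn :: "recf \<Rightarrow> nat \<Rightarrow> sym rule list" where
  "horn Zero k = [Rule (Fn Zero) ([0..<k] @ [k]) [(0, k)] [] []]"
| "horn Succ k = (if k = 0 then [] else [Rule (Fn Succ) ([0..<k] @ [k]) [] [(0, k)] []])"
| "horn (Proj i) k = (if i < k then [Rule (Fn (Proj i)) ([0..<k] @ [i]) [] [] []] else [])"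
| "horn (Comp f gs) k =
     Rule (Fn (Comp f gs)) ([0..<k] @ [k]) [] []
       ((Fn f, [Suc k..<Suc k + length gs] @ [k]) #
        map (\<lambda>i. (Fn (gs ! i), [0..<k] @ [Suc k + i])) [0..<length gs])
     # horn f (length gs) @ concat (map (\<lambda>g. horn g k) gs)"
| "horn (PrimRec f g) k = (if k = 0 then [] else
     Rule (Fn (PrimRec f g)) (0 # [1..<k] @ [k]) [(0, 0)] [] [(Fn f, [1..<k] @ [k])]
     # Rule (Fn (PrimRec f g)) (0 # [1..<k] @ [k]) [] [(Suc k, 0)]
         [(Fn (PrimRec f g), Suc k # [1..<k] @ [k + 2]),
          (Fn g, (Suc k # (k + 2) # [1..<k]) @ [k])]
     # horn f (k - 1) @ horn g (Suc k))"
| "horn (Minim f) k =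
     [Rule (Fn (Minim f)) ([0..<k] @ [k]) [(0, Suc k)] []
        [(MinAux f, k # [0..<k]), (Fn f, (k # [0..<k]) @ [Suc k])],
      Rule (MinAux f) (k # [0..<k]) [(0, k)] [] [],
      Rule (MinAux f) (k # [0..<k]) [] [(Suc k, k), (k + 2, k + 3)]
        [(MinAux f, Suc k # [0..<k]), (Fn f, (Suc k # [0..<k]) @ [k + 3])]]
     @ horn f (Suc k)"

lemma horn_inputs: "R \<in> set (horn g k) \<Longrightarrow> (a, i) \<in> set (inputs R) \<Longrightarrow> a = 0"
  by (induction g arbitrary: k) (auto split: if_splits)

lemma horn_head: "R \<in> set (horn g k) \<Longrightarrow> head_sym R \<noteq> Goal"
  by (induction g arbitrary: k) (auto split: if_splits)

text \<open>The intended model. The parameter \<open>h\<close> is the truth value granted to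
  \<open>Goal\<close>, later the statement that the function under study halts.\<close>

primrec sym_true :: "bool \<Rightarrow> sym \<Rightarrow> nat list \<Rightarrow> bool" where
  "sym_true h (Fn g) ws = (ws \<noteq> [] \<and> rec_eval g (butlast ws) = Some (last ws))"
| "sym_true h (MinAux f) ws = (ws \<noteq> [] \<and> (\<forall>i < hd ws. \<exists>w. rec_eval f (i # tl ws) = Some (Suc w)))"
| "sym_true h Goal ws = h"

text \<open>The intended model is closed under the rules, hence contains \<open>derivable\<close>,
  the least relation closed under them.\<close>

lemma horn_sound:
  assumes "R \<in> set (horn g k)" "\<nu> 0 = 0"
    "\<forall>(a, i) \<in> set (inputs R). \<sigma> i = \<nu> a"
    "\<forall>(i, j) \<in> set (succs R). \<sigma> j = Suc (\<sigma> i)"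
    "\<forall>(q, zs) \<in> set (body R). sym_true h q (map \<sigma> zs)"
  shows "sym_true h (head_sym R) (map \<sigma> (head_args R))"
  using assms
proof (induction g arbitrary: k)
  case Zero
  then show ?case by auto
next
  case Succ
  then show ?case by (auto split: if_splits list.split simp: upt_conv_Cons)
next
  case (Proj i)
  then show ?case by (auto split: if_splits)
next
  case (Comp f gs)
  show ?case
  proof (cases "R \<in> set (horn f (length gs) @ concat (map (\<lambda>g. horn g k) gs))")
    case True
    then show ?thesis using Comp by auto
  next
    case False
    with Comp.prems(1) have R: "R = Rule (Fn (Comp f gs)) ([0..<k] @ [k]) [] []
       ((Fn f, [Suc k..<Suc k + length gs] @ [k]) #
        map (\<lambda>i. (Fn (gs ! i), [0..<k] @ [Suc k + i])) [0..<length gs])" by simp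
    let ?ys = "map (\<lambda>g. rec_eval g (map \<sigma> [0..<k])) gs"
    have "?ys = map Some (map \<sigma> [Suc k..<Suc k + length gs])"
      using Comp.prems(5) unfolding R by (intro nth_equalityI) (auto simp del: upt_Suc)
    then show ?thesis using Comp.prems(5) unfolding R by (auto simp: comp_def)
  qed
next
  case (PrimRec f g)
  show ?case
  proof (cases "k = 0 \<or> R \<in> set (horn f (k - 1) @ horn g (Suc k))")
    case True
    then show ?thesis using PrimRec by (auto split: if_splits)
  next
    case False
    then show ?thesis using PrimRec.prems by auto
  qed
next
  case (Minim f)
  show ?case
  proof (cases "R \<in> set (horn f (Suc k))")
    case True
    then show ?thesis using Minim by auto
  next
    case False
    then consider
        (min) "R = Rule (Fn (Minim f)) ([0..<k] @ [k]) [(0, Suc k)] []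
        [(MinAux f, k # [0..<k]), (Fn f, (k # [0..<k]) @ [Suc k])]"
      | (base) "R = Rule (MinAux f) (k # [0..<k]) [(0, k)] [] []"
      | (step) "R = Rule (MinAux f) (k # [0..<k]) [] [(Suc k, k), (k + 2, k + 3)]
        [(MinAux f, Suc k # [0..<k]), (Fn f, (Suc k # [0..<k]) @ [k + 3])]"
      using Minim.prems(1) by auto
    then show ?thesis
    proof cases
      case min
      let ?xs = "map \<sigma> [0..<k]"
      have z: "rec_eval f (\<sigma> k # ?xs) = Some 0"
        and l: "\<And>i. i < \<sigma> k \<Longrightarrow> \<exists>w. rec_eval f (i # ?xs) = Some (Suc w)"
        using Minim.prems unfolding min by auto
      have "(LEAST y. rec_eval f (y # ?xs) = Some 0) = \<sigma> k"
        using z l by (intro Least_equality) (fastforce simp: not_less[symmetric])+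
      moreover have "\<exists>y. rec_eval f (y # ?xs) = Some 0 \<and> (\<forall>i<y. rec_eval f (i # ?xs) \<noteq> None)"
        using z l by (intro exI[of _ "\<sigma> k"]) fastforce
      ultimately show ?thesis unfolding min by simp
    next
      case base
      then show ?thesis using Minim.prems by auto
    next
      case step
      then show ?thesis using Minim.prems by (auto simp: less_Suc_eq)
    qed
  qed
qed

lemma derivable_sound:
  assumes "derivable P \<nu> q ws"
    and "\<And>R \<sigma>. \<lbrakk>R \<in> set P; \<forall>(a, i) \<in> set (inputs R). \<sigma> i = \<nu> a;
      \<forall>(i, j) \<in> set (succs R). \<sigma> j = Suc (\<sigma> i);
      \<forall>(q, zs) \<in> set (body R). I q (map \<sigma> zs)\<rbrakk> \<Longrightarrow> I (head_sym R) (map \<sigma> (head_args R))"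
  shows "I q ws"
  using assms(1) by (induction rule: derivable.induct) (rule assms(2), auto)

lemma derivable_ruleI:
  assumes "R \<in> set P" "\<forall>(a, i) \<in> set (inputs R). \<sigma> i = \<nu> a"
    "\<forall>(i, j) \<in> set (succs R). \<sigma> j = Suc (\<sigma> i)"
    "\<forall>(q, zs) \<in> set (body R). derivable P \<nu> q (map \<sigma> zs)"
    "q = head_sym R" "ws = map \<sigma> (head_args R)"
  shows "derivable P \<nu> q ws"
  using derivableI[OF assms(1-4)] assms(5,6) by simp

lemma map_nth_prefix [simp]: "map ((!) (xs @ ys)) [0..<length xs] = xs"
  by (intro nth_equalityI) (auto simp: nth_append)

lemma map_nth_infix:
  "length xs = m \<Longrightarrow> length ys = n - m \<Longrightarrow> map ((!) (xs @ ys @ zs)) [m..<n] = ys"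
  by (intro nth_equalityI) (auto simp: nth_append)

text \<open>In each case the values of the variables are listed in the order of their numbers, and
  indexing into this list is the substitution; intermediate results are appended behind the
  value.\<close>

lemma horn_complete:
  assumes "rec_eval g xs = Some v" "set (horn g (length xs)) \<subseteq> set P" "\<nu> 0 = 0"
  shows "derivable P \<nu> (Fn g) (xs @ [v])"
  using assms
proof (induction g arbitrary: xs v)
  case Zero
  then show ?case
    by (intro derivable_ruleI[where \<sigma> = "(!) (xs @ [v])" and R = "hd (horn Zero (length xs))"]) auto
next
  case Succ
  then obtain y ys where "xs = y # ys" by (cases xs) auto
  with Succ show ?case
    by (intro derivable_ruleI[where \<sigma> = "(!) (xs @ [v])" and R = "hd (horn Succ (length xs))"])
      (auto simp del: upt_Suc map_nth_prefix simp: map_nth_prefix[of "y # ys", simplified])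
next
  case (Proj i)
  then show ?case
    by (intro derivable_ruleI[where \<sigma> = "(!) (xs @ [v])" and R = "hd (horn (Proj i) (length xs))"])
     (auto split: if_splits simp: nth_append)
next
  case (Comp f gs)
  define ys where "ys = map (\<lambda>g. the (rec_eval g xs)) gs"
  from Comp.prems(1) have nn: "None \<notin> set (map (\<lambda>g. rec_eval g xs) gs)"
    and f: "rec_eval f ys = Some v"
    by (auto simp: Let_def ys_def comp_def split: if_splits)
  have g: "rec_eval (gs ! i) xs = Some (ys ! i)" if "i < length gs" for i
    using nn that unfolding ys_def by (cases "rec_eval (gs ! i) xs") (auto, metis image_eqI nth_mem)
  have len: "length ys = length gs" by (simp add: ys_def)
  have df: "derivable P \<nu> (Fn f) (ys @ [v])"
    by (rule Comp.IH(1)[OF f]) (use Comp.prems len in auto)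
  have dg: "derivable P \<nu> (Fn (gs ! i)) (xs @ [ys ! i])" if "i < length gs" for i
    by (rule Comp.IH(2)[OF _ g]) (use Comp.prems that in \<open>auto dest!: nth_mem\<close>)
  let ?\<sigma> = "(!) (xs @ [v] @ ys)"
  have m: "map ?\<sigma> [Suc (length xs)..<Suc (length xs + length gs)] = ys"
    using map_nth_infix[of "xs @ [v]" _ ys _ "[]"] len by (simp del: upt_Suc)
  show ?case
    using df dg Comp.prems(2) m len
    by (intro derivable_ruleI[where \<sigma> = ?\<sigma> and R = "hd (horn (Comp f gs) (length xs))"])
      (auto simp del: upt_Suc simp: nth_append)
next
  case (PrimRec f g)
  then obtain n ys where xs: "xs = n # ys" by (cases xs) auto
  let ?h = "\<lambda>n. rec_eval (PrimRec f g) (n # ys)"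
  have "?h n = Some v \<Longrightarrow> derivable P \<nu> (Fn (PrimRec f g)) (n # ys @ [v])" for n v
  proof (induction n arbitrary: v)
    case 0
    then have "rec_eval f ys = Some v" by simp
    then have d: "derivable P \<nu> (Fn f) (ys @ [v])"
      using PrimRec.IH(1)[of ys v] PrimRec.prems xs by auto
    have m: "map ((!) (0 # ys @ [v])) [Suc 0..<Suc (length ys)] = ys"
      using map_nth_infix[of "[0]" "Suc 0" ys "Suc (length ys)" "[v]"] by (simp del: upt_Suc)
    show ?case
      using d m PrimRec.prems xs
      by (intro derivable_ruleI[where \<sigma> = "(!) (0 # ys @ [v])" and R = "hd (horn (PrimRec f g) (length xs))"])
       (auto simp del: upt_Suc simp: nth_append)
  next
    case (Suc n)
    then obtain r where r: "?h n = Some r" "rec_eval g (n # r # ys) = Some v"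
      by (auto split: option.splits)
    have d1: "derivable P \<nu> (Fn (PrimRec f g)) (n # ys @ [r])"
      by (rule Suc.IH[OF r(1)])
    have d2: "derivable P \<nu> (Fn g) (n # r # ys @ [v])"
      using PrimRec.IH(2)[OF r(2)] PrimRec.prems xs by auto
    let ?\<sigma> = "(!) (Suc n # ys @ [v, n, r])"
    have m: "map ?\<sigma> [Suc 0..<Suc (length ys)] = ys"
      using map_nth_infix[of "[Suc n]" "Suc 0" ys "Suc (length ys)"] by (simp del: upt_Suc)
    show ?case
      using d1 d2 m PrimRec.prems xs
      by (intro derivable_ruleI[where \<sigma> = ?\<sigma> and R = "horn (PrimRec f g) (length xs) ! 1"])
       (auto simp del: upt_Suc simp: nth_append)
  qed
  with PrimRec.prems xs show ?case by simp
next
  case (Minim f)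
  let ?aux = "\<lambda>y. derivable P \<nu> (MinAux f) (y # xs)"
  let ?R = "\<lambda>i. horn (Minim f) (length xs) ! i"
  from Minim.prems(1) obtain y where y: "rec_eval f (y # xs) = Some 0"
      "\<And>i. i < y \<Longrightarrow> rec_eval f (i # xs) \<noteq> None"
    and v: "v = (LEAST y. rec_eval f (y # xs) = Some 0)"
    by (auto simp only: rec_eval.simps split: if_splits)
  have z: "rec_eval f (v # xs) = Some 0"
    unfolding v by (rule LeastI) (rule y(1))
  have "v \<le> y"
    unfolding v by (rule Least_le) (rule y(1))
  then have nn: "rec_eval f (i # xs) \<noteq> None" if "i < v" for i
    using y(2) that by simp
  have nz: "rec_eval f (i # xs) \<noteq> Some 0" if "i < v" for i
    using that not_less_Least unfolding v by blast
  have df: "derivable P \<nu> (Fn f) (i # xs @ [w])" if "rec_eval f (i # xs) = Some w" for i w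
    using Minim.IH[OF that] Minim.prems by auto
  have "y \<le> v \<Longrightarrow> ?aux y" for y
  proof (induction y)
    case 0
    show ?case
      using Minim.prems
      by (intro derivable_ruleI[where \<sigma> = "(!) (xs @ [0])" and R = "?R 1"])
       (auto simp del: upt_Suc simp: nth_append)
  next
    case (Suc y)
    obtain u where "rec_eval f (y # xs) = Some u"
      using nn[of y] Suc.prems by auto
    moreover have "u \<noteq> 0"
      using nz[of y] Suc.prems calculation by auto
    ultimately obtain w where w: "rec_eval f (y # xs) = Some (Suc w)"
      by (auto simp: gr0_conv_Suc)
    show ?case
      using Minim.prems df[OF w] Suc
      by (intro derivable_ruleI[where \<sigma> = "(!) (xs @ [Suc y, y, w, Suc w])" and R = "?R 2"])
       (auto simp del: upt_Suc simp: nth_append)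
  qed
  then show ?case
    using Minim.prems df[OF z]
    by (intro derivable_ruleI[where \<sigma> = "(!) (xs @ [v, 0])" and R = "?R 0"])
     (auto simp del: upt_Suc simp: nth_append)
qed

section \<open>Synchronous quantification over all timed words\<close>

text \<open>Since all traces share the timestamps \<open>W\<close> and one proposition is enough,
  trace \<open>x\<close> reduces to the set \<open>L x\<close> of events carrying it, and
  \<open>TopV x\<close> coincides with \<open>Top\<close>.\<close>

primrec sem :: "real set \<Rightarrow> (nat \<Rightarrow> real set) \<Rightarrow> real \<Rightarrow> mtl \<Rightarrow> bool" where
  "sem W L t Top = (t \<in> W)"
| "sem W L t (TopV x) = (t \<in> W)"
| "sem W L t (PropV p x) = (t \<in> L x)"
| "sem W L t (And \<psi>1 \<psi>2) = (sem W L t \<psi>1 \<and> sem W L t \<psi>2)"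
| "sem W L t (Neg \<psi>) = (\<not> sem W L t \<psi>)"
| "sem W L t (Until \<psi>1 I \<psi>2) =
     (\<exists>t' \<in> W. t < t' \<and> t' - t \<in> intvl_set I \<and> sem W L t' \<psi>2 \<and>
        (\<forall>t'' \<in> W. t < t'' \<and> t'' < t' \<longrightarrow> sem W L t'' \<psi>1))"
| "sem W L t (Since \<psi>1 I \<psi>2) =
     (\<exists>t' \<in> W. t' < t \<and> t - t' \<in> intvl_set I \<and> sem W L t' \<psi>2 \<and>
        (\<forall>t'' \<in> W. t' < t'' \<and> t'' < t \<longrightarrow> sem W L t'' \<psi>1))"

text \<open>Evaluation starts at time 0, which need not be an event, and away from events both
  \<open>PropV\<close> and its negation fail. Formulas whose atoms are all guarded by a temporal
  operator avoid this.\<close>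

primrec temporal :: "mtl \<Rightarrow> bool" where
  "temporal Top = False"
| "temporal (TopV x) = False"
| "temporal (PropV p x) = False"
| "temporal (And \<psi>1 \<psi>2) = (temporal \<psi>1 \<and> temporal \<psi>2)"
| "temporal (Neg \<psi>) = temporal \<psi>"
| "temporal (Until \<psi>1 I \<psi>2) = True"
| "temporal (Since \<psi>1 I \<psi>2) = True"

text \<open>With no trace assigned \<open>event_at\<close> is false everywhere; a nonempty domain
  ties \<open>W\<close> to the assignment.\<close>

definition represents :: "nat \<Rightarrow> assignment \<Rightarrow> real set \<Rightarrow> (nat \<Rightarrow> real set) \<Rightarrow> bool" where
  "represents p \<Pi> W L \<longleftrightarrow> dom \<Pi> \<noteq> {} \<and> (\<forall>x \<rho>. \<Pi> x = Some \<rho> \<longrightarrow>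
     timestamps \<rho> = W \<and> (\<forall>t \<in> W. t \<in> L x \<longleftrightarrow> p \<in> letter_at \<rho> t))"

lemma represents_event_at: "represents p \<Pi> W L \<Longrightarrow> event_at \<Pi> t \<longleftrightarrow> t \<in> W"
  unfolding represents_def event_at_def ran_def by (auto simp: dom_def)

text \<open>Negation normal forms behave classically only at events, hence the last assumption.\<close>

lemma nnf_sat_iff_sem:
  assumes "represents p \<Pi> W L" "mtl_vars \<psi> \<subseteq> dom \<Pi>" "mtl_over {p} \<psi>" "t \<in> W \<or> temporal \<psi>"
  shows "nnf_sat \<Pi> t (to_nnf b \<psi>) \<longleftrightarrow> sem W L t \<psi> = b"
  using assms(2-)
proof (induction \<psi> arbitrary: t b)
  case (Until \<psi>1 I \<psi>2)
  then have "nnf_sat \<Pi> t (to_nnf b \<psi>1) \<longleftrightarrow> sem W L t \<psi>1 = b"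
    "nnf_sat \<Pi> t (to_nnf b \<psi>2) \<longleftrightarrow> sem W L t \<psi>2 = b" if "t \<in> W" for t b
    using that by auto
  then show ?case
    by (cases b) (auto simp: represents_event_at[OF assms(1)] Ball_def Bex_def cong: conj_cong)
next
  case (Since \<psi>1 I \<psi>2)
  then have "nnf_sat \<Pi> t (to_nnf b \<psi>1) \<longleftrightarrow> sem W L t \<psi>1 = b"
    "nnf_sat \<Pi> t (to_nnf b \<psi>2) \<longleftrightarrow> sem W L t \<psi>2 = b" if "t \<in> W" for t b
    using that by auto
  then show ?case
    by (cases b) (auto simp: represents_event_at[OF assms(1)] Ball_def Bex_def cong: conj_cong)
next
  case Top
  then show ?case using represents_event_at[OF assms(1)] by auto
next
  case (TopV x)
  then obtain \<rho> where "\<Pi> x = Some \<rho>" by auto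
  then show ?case using assms(1) TopV by (auto simp: represents_def)
next
  case (PropV q x)
  then obtain \<rho> where "\<Pi> x = Some \<rho>" by auto
  then show ?case using assms(1) PropV by (auto simp: represents_def)
next
  case (And \<psi>1 \<psi>2)
  then have "nnf_sat \<Pi> t (to_nnf b \<psi>1) \<longleftrightarrow> sem W L t \<psi>1 = b"
    "nnf_sat \<Pi> t (to_nnf b \<psi>2) \<longleftrightarrow> sem W L t \<psi>2 = b"
    by auto
  then show ?case by (cases b) simp_all
next
  case (Neg \<psi>)
  then have "nnf_sat \<Pi> t (to_nnf (\<not> b) \<psi>) \<longleftrightarrow> sem W L t \<psi> = (\<not> b)"
    by simp
  then show ?case by (cases b) simp_all
qed

text \<open>The sets need not be restricted to subsets of \<open>W\<close>, as a temporal matrix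
  reads them only at events.\<close>

primrec qsem :: "real set \<Rightarrow> (nat \<Rightarrow> real set) \<Rightarrow> hypermtl \<Rightarrow> bool" where
  "qsem W L (QF \<psi>) = sem W L 0 \<psi>"
| "qsem W L (Ex x \<phi>) = (\<exists>S. qsem W (L(x := S)) \<phi>)"
| "qsem W L (All x \<phi>) = (\<forall>S. qsem W (L(x := S)) \<phi>)"

lemma finite_timestamps: "finite (timestamps \<rho>)"
  by (simp add: timestamps_def)

lemma timestamps_nonneg: "\<rho> \<in> timed_words \<Sigma> \<Longrightarrow> timestamps \<rho> \<subseteq> {0..}"
  by (auto simp: timestamps_def timed_words_def)

lemma timed_word_exists:
  assumes "finite W" "W \<subseteq> {0..}" "p \<in> AP"
  obtains \<rho> where "\<rho> \<in> timed_words (Pow AP)" "timestamps \<rho> = W"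
    "\<And>t. t \<in> W \<Longrightarrow> t \<in> S \<longleftrightarrow> p \<in> letter_at \<rho> t"
proof
  let ?\<rho> = "map (\<lambda>t. (if t \<in> S then {p} else {}, t)) (sorted_list_of_set W)"
  show "?\<rho> \<in> timed_words (Pow AP)"
    using assms strict_sorted_list_of_set[of W] by (auto simp: timed_words_def comp_def split: if_splits)
  show "timestamps ?\<rho> = W"
    using assms(1) by (auto simp: timestamps_def image_image)
  show "t \<in> S \<longleftrightarrow> p \<in> letter_at ?\<rho> t" if "t \<in> W" for t
  proof -
    have "letter_at ?\<rho> t = (if t \<in> S then {p} else {})"
      unfolding letter_at_def using that assms(1) by (intro the_equality) auto
    then show ?thesis by simp
  qed
qed

lemma represents_update:
  assumes "represents p \<Pi> W L \<or> \<Pi> = Map.empty" "timestamps \<rho> = W"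
    "\<And>t. t \<in> W \<Longrightarrow> t \<in> S \<longleftrightarrow> p \<in> letter_at \<rho> t"
  shows "represents p (\<Pi>(x \<mapsto> \<rho>)) W (L(x := S))"
  using assms unfolding represents_def by (auto split: if_splits)

lemma sync_sat_iff_qsem:
  assumes "finite W" "W \<subseteq> {0..}" "p \<in> AP"
    and "represents p \<Pi> W L" "free_vars \<phi> \<subseteq> dom \<Pi>"
    "mtl_over {p} (matrix \<phi>)" "temporal (matrix \<phi>)"
  shows "sync_sat (timed_words (Pow AP)) \<Pi> 0 \<phi> \<longleftrightarrow> qsem W L \<phi>"
  using assms(4-)
proof (induction \<phi> arbitrary: \<Pi> L)
  case (QF \<psi>)
  then show ?case by (simp add: nnf_sat_iff_sem)
next
  case (Ex x \<phi>)
  have sync: "(\<forall>\<rho>' \<in> ran \<Pi>. timestamps \<rho> = timestamps \<rho>') \<longleftrightarrow> timestamps \<rho> = W" for \<rho>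
    using Ex.prems(1) unfolding represents_def ran_def by (auto simp: dom_def)
  have IH: "sync_sat (timed_words (Pow AP)) (\<Pi>(x \<mapsto> \<rho>)) 0 \<phi> \<longleftrightarrow> qsem W (L(x := S)) \<phi>"
    if "timestamps \<rho> = W" "\<And>t. t \<in> W \<Longrightarrow> t \<in> S \<longleftrightarrow> p \<in> letter_at \<rho> t" for \<rho> S
    using Ex.prems that by (intro Ex.IH represents_update) auto
  have "qsem W (L(x := {t. p \<in> letter_at \<rho> t})) \<phi>"
    if "timestamps \<rho> = W" "sync_sat (timed_words (Pow AP)) (\<Pi>(x \<mapsto> \<rho>)) 0 \<phi>" for \<rho>
    using IH[OF that(1), of "{t. p \<in> letter_at \<rho> t}"] that(2) by auto
  moreover have "\<exists>\<rho> \<in> timed_words (Pow AP). timestamps \<rho> = W \<and>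
      sync_sat (timed_words (Pow AP)) (\<Pi>(x \<mapsto> \<rho>)) 0 \<phi>" if "qsem W (L(x := S)) \<phi>" for S
    using timed_word_exists[OF assms(1-3), of S] IH that by metis
  ultimately show ?case by (auto simp: sync)
next
  case (All x \<phi>)
  have sync: "(\<forall>\<rho>' \<in> ran \<Pi>. timestamps \<rho> = timestamps \<rho>') \<longleftrightarrow> timestamps \<rho> = W" for \<rho>
    using All.prems(1) unfolding represents_def ran_def by (auto simp: dom_def)
  have IH: "sync_sat (timed_words (Pow AP)) (\<Pi>(x \<mapsto> \<rho>)) 0 \<phi> \<longleftrightarrow> qsem W (L(x := S)) \<phi>"
    if "timestamps \<rho> = W" "\<And>t. t \<in> W \<Longrightarrow> t \<in> S \<longleftrightarrow> p \<in> letter_at \<rho> t" for \<rho> S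
    using All.prems that by (intro All.IH represents_update) auto
  have "sync_sat (timed_words (Pow AP)) (\<Pi>(x \<mapsto> \<rho>)) 0 \<phi>"
    if "timestamps \<rho> = W" "qsem W (L(x := {t. p \<in> letter_at \<rho> t})) \<phi>" for \<rho>
    using IH[OF that(1), of "{t. p \<in> letter_at \<rho> t}"] that(2) by auto
  moreover have "\<exists>\<rho> \<in> timed_words (Pow AP). timestamps \<rho> = W \<and>
      \<not> sync_sat (timed_words (Pow AP)) (\<Pi>(x \<mapsto> \<rho>)) 0 \<phi>" if "\<not> qsem W (L(x := S)) \<phi>" for S
    using timed_word_exists[OF assms(1-3), of S] IH that by metis
  ultimately show ?case by (auto simp: sync)
qed

lemma sync_sat_first_iff_qsem:
  assumes "finite W" "W \<subseteq> {0..}" "p \<in> AP" "timestamps \<rho> = W"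
    and "free_vars \<phi> \<subseteq> {x}" "mtl_over {p} (matrix \<phi>)" "temporal (matrix \<phi>)"
    and "\<And>t. t \<in> W \<Longrightarrow> t \<in> S \<longleftrightarrow> p \<in> letter_at \<rho> t"
  shows "sync_sat (timed_words (Pow AP)) [x \<mapsto> \<rho>] 0 \<phi> \<longleftrightarrow> qsem W (L(x := S)) \<phi>"
  using assms by (intro sync_sat_iff_qsem represents_update) auto

text \<open>The first quantifier fixes the set of timestamps.\<close>

lemma sync_models_Ex:
  assumes "p \<in> AP" "free_vars \<phi> \<subseteq> {x}" "mtl_over {p} (matrix \<phi>)" "temporal (matrix \<phi>)"
  shows "sync_models (timed_words (Pow AP)) (Ex x \<phi>) \<longleftrightarrow>
    (\<exists>W. finite W \<and> W \<subseteq> {0..} \<and> qsem W L (Ex x \<phi>))"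
proof
  assume "sync_models (timed_words (Pow AP)) (Ex x \<phi>)"
  then obtain \<rho> where \<rho>: "\<rho> \<in> timed_words (Pow AP)" "sync_sat (timed_words (Pow AP)) [x \<mapsto> \<rho>] 0 \<phi>"
    by (auto simp: sync_models_def)
  then have "qsem (timestamps \<rho>) (L(x := {t. p \<in> letter_at \<rho> t})) \<phi>"
    using assms by (subst (asm) sync_sat_first_iff_qsem)
      (auto simp: finite_timestamps timestamps_nonneg)
  then show "\<exists>W. finite W \<and> W \<subseteq> {0..} \<and> qsem W L (Ex x \<phi>)"
    using finite_timestamps[of \<rho>] timestamps_nonneg[OF \<rho>(1)] by auto
next
  assume "\<exists>W. finite W \<and> W \<subseteq> {0..} \<and> qsem W L (Ex x \<phi>)"
  then obtain W S where W: "finite W" "W \<subseteq> {0..}" "qsem W (L(x := S)) \<phi>" by auto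
  obtain \<rho> where \<rho>: "\<rho> \<in> timed_words (Pow AP)" "timestamps \<rho> = W"
    "\<And>t. t \<in> W \<Longrightarrow> t \<in> S \<longleftrightarrow> p \<in> letter_at \<rho> t"
    using timed_word_exists[OF W(1,2) assms(1)] by metis
  have "sync_sat (timed_words (Pow AP)) [x \<mapsto> \<rho>] 0 \<phi>"
    using sync_sat_first_iff_qsem[OF W(1,2) assms(1) \<rho>(2) assms(2-4) \<rho>(3)] W(3) by simp
  then show "sync_models (timed_words (Pow AP)) (Ex x \<phi>)"
    using \<rho>(1) by (auto simp: sync_models_def)
qed

lemma sync_models_All:
  assumes "p \<in> AP" "free_vars \<phi> \<subseteq> {x}" "mtl_over {p} (matrix \<phi>)" "temporal (matrix \<phi>)"
  shows "sync_models (timed_words (Pow AP)) (All x \<phi>) \<longleftrightarrow>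
    (\<forall>W. finite W \<longrightarrow> W \<subseteq> {0..} \<longrightarrow> qsem W L (All x \<phi>))"
proof
  assume *: "sync_models (timed_words (Pow AP)) (All x \<phi>)"
  show "\<forall>W. finite W \<longrightarrow> W \<subseteq> {0..} \<longrightarrow> qsem W L (All x \<phi>)"
  proof (clarsimp)
    fix W :: "real set" and S assume W: "finite W" "W \<subseteq> {0..}"
    obtain \<rho> where \<rho>: "\<rho> \<in> timed_words (Pow AP)" "timestamps \<rho> = W"
      "\<And>t. t \<in> W \<Longrightarrow> t \<in> S \<longleftrightarrow> p \<in> letter_at \<rho> t"
      using timed_word_exists[OF W(1,2) assms(1)] by metis
    have "sync_sat (timed_words (Pow AP)) [x \<mapsto> \<rho>] 0 \<phi>"
      using * \<rho>(1) by (simp add: sync_models_def)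
    then show "qsem W (L(x := S)) \<phi>"
      using sync_sat_first_iff_qsem[OF W assms(1) \<rho>(2) assms(2-4) \<rho>(3)] by simp
  qed
next
  assume *: "\<forall>W. finite W \<longrightarrow> W \<subseteq> {0..} \<longrightarrow> qsem W L (All x \<phi>)"
  have "sync_sat (timed_words (Pow AP)) [x \<mapsto> \<rho>] 0 \<phi>" if "\<rho> \<in> timed_words (Pow AP)" for \<rho>
  proof -
    have "qsem (timestamps \<rho>) (L(x := {t. p \<in> letter_at \<rho> t})) \<phi>"
      using * finite_timestamps timestamps_nonneg[OF that] by auto
    then show ?thesis
      using assms that by (subst sync_sat_first_iff_qsem)
        (auto simp: finite_timestamps timestamps_nonneg)
  qed
  then show "sync_models (timed_words (Pow AP)) (All x \<phi>)"
    by (auto simp: sync_models_def)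
qed

section \<open>Quantifier blocks over even and odd trace variables\<close>

text \<open>The numbering \<open>k + k + b\<close> separates the blocks by parity and lets the code
  be computed with addition alone.\<close>

primrec quantify :: "(nat \<Rightarrow> hypermtl \<Rightarrow> hypermtl) \<Rightarrow> nat \<Rightarrow> nat \<Rightarrow> hypermtl \<Rightarrow> hypermtl" where
  "quantify Q b 0 \<phi> = \<phi>"
| "quantify Q b (Suc k) \<phi> = Q (k + k + b) (quantify Q b k \<phi>)"

definition override :: "nat \<Rightarrow> nat \<Rightarrow> (nat \<Rightarrow> real set) \<Rightarrow> (nat \<Rightarrow> real set) \<Rightarrow> nat \<Rightarrow> real set" where
  "override b k E L x = (if \<exists>j < k. x = j + j + b then E x else L x)"

lemma override_0: "override b 0 E L = L"
  by (auto simp: override_def)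

lemma override_Suc: "override b (Suc k) E L = override b k E (L(k + k + b := E (k + k + b)))"
  by (auto simp: override_def fun_eq_iff less_Suc_eq)

lemma override_upd: "override b k (E(k + k + b := S)) L = override b k E L"
  by (auto simp: override_def fun_eq_iff)

lemma qsem_quantify_Ex: "qsem W L (quantify Ex b k \<phi>) \<longleftrightarrow> (\<exists>E. qsem W (override b k E L) \<phi>)"
proof (induction k arbitrary: L)
  case (Suc k)
  have "(\<exists>S E. qsem W (override b k E (L(k + k + b := S))) \<phi>) \<longleftrightarrow>
        (\<exists>E. qsem W (override b (Suc k) E L) \<phi>)"
    unfolding override_Suc by (metis fun_upd_same override_upd)
  then show ?case by (simp only: quantify.simps qsem.simps Suc)
qed (simp add: override_0)

lemma qsem_quantify_All: "qsem W L (quantify All b k \<phi>) \<longleftrightarrow> (\<forall>E. qsem W (override b k E L) \<phi>)"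
proof (induction k arbitrary: L)
  case (Suc k)
  have "(\<forall>S E. qsem W (override b k E (L(k + k + b := S))) \<phi>) \<longleftrightarrow>
        (\<forall>E. qsem W (override b (Suc k) E L) \<phi>)"
    unfolding override_Suc by (metis fun_upd_same override_upd)
  then show ?case by (simp only: quantify.simps qsem.simps Suc)
qed (simp add: override_0)

lemma sem_cong: "(\<And>x. x \<in> mtl_vars \<psi> \<Longrightarrow> L x = L' x) \<Longrightarrow> sem W L t \<psi> = sem W L' t \<psi>"
  by (induction \<psi> arbitrary: t) auto

definition interleave :: "(nat \<Rightarrow> real set) \<Rightarrow> (nat \<Rightarrow> real set) \<Rightarrow> nat \<Rightarrow> real set" where
  "interleave E C x = (if even x then E x else C x)"

lemma sem_override:
  assumes "mtl_vars \<psi> \<subseteq> {..<k + k}"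
  shows "sem W (override 1 k C (override 0 k E L)) t \<psi> = sem W (interleave E C) t \<psi>"
proof (rule sem_cong)
  fix x assume "x \<in> mtl_vars \<psi>"
  then have "x < k + k" using assms by auto
  then have "even x \<longleftrightarrow> (\<exists>j<k. x = j + j + 0)" "odd x \<longleftrightarrow> (\<exists>j<k. x = j + j + 1)"
    by presburger+
  then show "override 1 k C (override 0 k E L) x = interleave E C x"
    unfolding override_def interleave_def by (simp only: if_True if_False split: if_split) blast
qed

lemma matrix_quantify [simp]:
  "matrix (quantify Ex b k \<phi>) = matrix \<phi>" "matrix (quantify All b k \<phi>) = matrix \<phi>"
  by (induction k) auto

lemma free_vars_quantify:
  "free_vars (quantify Ex b k \<phi>) = free_vars \<phi> - {x. \<exists>j<k. x = j + j + b}"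
  "free_vars (quantify All b k \<phi>) = free_vars \<phi> - {x. \<exists>j<k. x = j + j + b}"
  by (induction k) (auto simp: less_Suc_eq)

lemma binders_quantify:
  "binders (quantify Ex b k \<phi>) = rev (map (\<lambda>j. j + j + b) [0..<k]) @ binders \<phi>"
  "binders (quantify All b k \<phi>) = rev (map (\<lambda>j. j + j + b) [0..<k]) @ binders \<phi>"
  by (induction k) auto

text \<open>Splitting by parity makes the trace numbers in the matrix independent of the block
  length, so blocks can be lengthened without renaming.\<close>

definition exall :: "nat \<Rightarrow> mtl \<Rightarrow> hypermtl" where
  "exall k \<psi> = quantify Ex 0 k (quantify All 1 k (QF \<psi>))"

definition allex :: "nat \<Rightarrow> mtl \<Rightarrow> hypermtl" where
  "allex k \<psi> = quantify All 0 k (quantify Ex 1 k (QF \<psi>))"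

lemma evens_Un_odds: "{x. \<exists>j<k. x = j + j + 0} \<union> {x. \<exists>j<k. x = j + j + 1} = {..<k + k :: nat}"
proof -
  have "(\<exists>j<k. x = j + j + 0) \<or> (\<exists>j<k. x = j + j + 1)" if "x < k + k" for x
    using that by presburger
  then show ?thesis by auto
qed

lemma free_vars_exall: "mtl_vars \<psi> \<subseteq> {..<k + k} \<Longrightarrow> free_vars (exall k \<psi>) = {}"
  unfolding exall_def free_vars_quantify free_vars.simps Diff_eq_empty_iff[symmetric]
  using evens_Un_odds[of k] by blast

lemma free_vars_allex: "mtl_vars \<psi> \<subseteq> {..<k + k} \<Longrightarrow> free_vars (allex k \<psi>) = {}"
  unfolding allex_def free_vars_quantify free_vars.simps
  using evens_Un_odds[of k] by blast

lemma distinct_doubles: "distinct (rev (map (\<lambda>j. j + j) [0..<k]) @ rev (map (\<lambda>j. Suc (j + j)) [0..<k]))"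
proof -
  have "j + j \<noteq> Suc (i + i)" for i j :: nat by presburger
  then show ?thesis by (auto simp: distinct_map inj_on_def)
qed

lemma mtl_over_mono: "mtl_over A \<psi> \<Longrightarrow> A \<subseteq> B \<Longrightarrow> mtl_over B \<psi>"
  by (induction \<psi>) auto

lemma closed_exall:
  assumes "p \<in> AP" "mtl_over {p} \<psi>" "mtl_vars \<psi> \<subseteq> {..<k + k}"
  shows "closed_hypermtl AP (exall k \<psi>)" "closed_hypermtl AP (allex k \<psi>)"
  using assms mtl_over_mono[OF assms(2), of AP] distinct_doubles[of k]
    free_vars_exall[OF assms(3)] free_vars_allex[OF assms(3)]
  by (auto simp: closed_hypermtl_def) (auto simp: exall_def allex_def binders_quantify)

lemma exists_forall_exall: "exists_forall (exall k \<psi>)"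
proof -
  have "all_block (quantify All b k (QF \<psi>))" for b k by (induction k) auto
  then have "exists_forall (quantify All b k (QF \<psi>))" for b k by (cases k) auto
  moreover have "exists_forall \<phi> \<Longrightarrow> exists_forall (quantify Ex b k \<phi>)" for b k \<phi> by (induction k) auto
  ultimately show ?thesis by (simp add: exall_def)
qed

lemma forall_exists_allex: "forall_exists (allex k \<psi>)"
proof -
  have "ex_block (quantify Ex b k (QF \<psi>))" for b k by (induction k) auto
  then have "forall_exists (quantify Ex b k (QF \<psi>))" for b k by (cases k) auto
  moreover have "forall_exists \<phi> \<Longrightarrow> forall_exists (quantify All b k \<phi>)" for b k \<phi> by (induction k) auto
  ultimately show ?thesis by (simp add: allex_def)
qed

lemma sync_models_exall:
  assumes "p \<in> AP" "mtl_over {p} \<psi>" "temporal \<psi>" "mtl_vars \<psi> \<subseteq> {..<k + k}" "k > 0"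
  shows "sync_models (timed_words (Pow AP)) (exall k \<psi>) \<longleftrightarrow>
    (\<exists>W. finite W \<and> W \<subseteq> {0..} \<and> (\<exists>E. \<forall>C. sem W (interleave E C) 0 \<psi>))"
proof -
  obtain k' where k: "k = Suc k'" using assms(5) gr0_implies_Suc by blast
  let ?\<phi> = "quantify Ex 0 k' (quantify All 1 k (QF \<psi>))"
  have e: "exall k \<psi> = Ex (k' + k') ?\<phi>" by (simp add: exall_def k)
  have "free_vars ?\<phi> \<subseteq> {k' + k'}" using free_vars_exall[OF assms(4)] unfolding e by auto
  then have "sync_models (timed_words (Pow AP)) (exall k \<psi>) \<longleftrightarrow>
    (\<exists>W. finite W \<and> W \<subseteq> {0..} \<and> qsem W (\<lambda>_. {}) (exall k \<psi>))"
    unfolding e using assms by (intro sync_models_Ex) auto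
  then show ?thesis
    by (simp add: exall_def qsem_quantify_Ex qsem_quantify_All sem_override[OF assms(4), simplified])
qed

text \<open>Once reduced to \<open>qsem\<close>, negation is classical and passes through both
  blocks, including the choice of \<open>W\<close> by the first quantifier.\<close>

lemma sync_models_allex:
  assumes "p \<in> AP" "mtl_over {p} \<psi>" "temporal \<psi>" "mtl_vars \<psi> \<subseteq> {..<k + k}" "k > 0"
  shows "sync_models (timed_words (Pow AP)) (allex k (Neg \<psi>)) \<longleftrightarrow>
    \<not> sync_models (timed_words (Pow AP)) (exall k \<psi>)"
proof -
  obtain k' where k: "k = Suc k'" using assms(5) gr0_implies_Suc by blast
  let ?\<phi> = "quantify All 0 k' (quantify Ex 1 k (QF (Neg \<psi>)))"
  have e: "allex k (Neg \<psi>) = All (k' + k') ?\<phi>" by (simp add: allex_def k)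
  have "free_vars ?\<phi> \<subseteq> {k' + k'}" using free_vars_allex[of "Neg \<psi>" k] assms(4) unfolding e by auto
  then have "sync_models (timed_words (Pow AP)) (allex k (Neg \<psi>)) \<longleftrightarrow>
    (\<forall>W. finite W \<longrightarrow> W \<subseteq> {0..} \<longrightarrow> qsem W (\<lambda>_. {}) (allex k (Neg \<psi>)))"
    unfolding e using assms by (intro sync_models_All) auto
  then show ?thesis
    by (simp add: allex_def qsem_quantify_Ex qsem_quantify_All sem_override[OF assms(4), simplified]
        sync_models_exall[OF assms]) blast
qed

section \<open>Horn derivations as grids\<close>

definition eventually_in :: "intvl \<Rightarrow> mtl \<Rightarrow> mtl" where
  "eventually_in I \<psi> = Until Top I \<psi>"

definition ev :: "mtl \<Rightarrow> mtl" where "ev = eventually_in (Unbnd False 0)"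
definition ev_lt1 :: "mtl \<Rightarrow> mtl" where "ev_lt1 = eventually_in (Bnd False 0 1 False)"
definition ev_le1 :: "mtl \<Rightarrow> mtl" where "ev_le1 = eventually_in (Bnd False 0 1 True)"
definition ev_ge1 :: "mtl \<Rightarrow> mtl" where "ev_ge1 = eventually_in (Unbnd True 1)"
definition nxt :: "mtl \<Rightarrow> mtl" where "nxt \<psi> = Until (Neg Top) (Unbnd False 0) \<psi>"
definition alw :: "mtl \<Rightarrow> mtl" where "alw \<psi> = Neg (ev (Neg \<psi>))"
definition imp :: "mtl \<Rightarrow> mtl \<Rightarrow> mtl" where "imp \<psi>1 \<psi>2 = Neg (And \<psi>1 (Neg \<psi>2))"
definition now_or_lt1 :: "mtl \<Rightarrow> mtl" where "now_or_lt1 \<psi> = imp (Neg \<psi>) (ev_lt1 \<psi>)"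

text \<open>The empty conjunction is not \<open>Top\<close>, which fails at times that are not
  events.\<close>

primrec conj :: "mtl list \<Rightarrow> mtl" where
  "conj [] = imp Top Top"
| "conj (\<psi> # \<psi>s) = And \<psi> (conj \<psi>s)"

definition disj :: "mtl list \<Rightarrow> mtl" where "disj \<psi>s = Neg (conj (map Neg \<psi>s))"

primrec nth_next :: "nat \<Rightarrow> mtl \<Rightarrow> mtl" where
  "nth_next 0 \<psi> = \<psi>"
| "nth_next (Suc n) \<psi> = nxt (nth_next n \<psi>)"

lemma sem_ev [simp]: "sem W L t (ev \<psi>) \<longleftrightarrow> (\<exists>t' \<in> W. t < t' \<and> sem W L t' \<psi>)"
  by (auto simp: ev_def eventually_in_def)

lemma sem_ev_lt1 [simp]:
  "sem W L t (ev_lt1 \<psi>) \<longleftrightarrow> (\<exists>t' \<in> W. t < t' \<and> t' < t + 1 \<and> sem W L t' \<psi>)"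
  by (fastforce simp: ev_lt1_def eventually_in_def)

lemma sem_ev_le1 [simp]:
  "sem W L t (ev_le1 \<psi>) \<longleftrightarrow> (\<exists>t' \<in> W. t < t' \<and> t' \<le> t + 1 \<and> sem W L t' \<psi>)"
  by (fastforce simp: ev_le1_def eventually_in_def)

lemma sem_ev_ge1 [simp]:
  "sem W L t (ev_ge1 \<psi>) \<longleftrightarrow> (\<exists>t' \<in> W. t + 1 \<le> t' \<and> sem W L t' \<psi>)"
  unfolding ev_ge1_def eventually_in_def sem.simps by (rule bex_cong) auto

lemma sem_nxt [simp]: "sem W L t (nxt \<psi>) \<longleftrightarrow>
    (\<exists>t' \<in> W. t < t' \<and> (\<forall>s \<in> W. t < s \<longrightarrow> t' \<le> s) \<and> sem W L t' \<psi>)"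
  by (fastforce simp: nxt_def not_less)

lemma sem_alw [simp]: "sem W L t (alw \<psi>) \<longleftrightarrow> (\<forall>t' \<in> W. t < t' \<longrightarrow> sem W L t' \<psi>)"
  by (auto simp: alw_def)

lemma sem_imp [simp]: "sem W L t (imp \<psi>1 \<psi>2) \<longleftrightarrow> (sem W L t \<psi>1 \<longrightarrow> sem W L t \<psi>2)"
  by (auto simp: imp_def)

lemma sem_now_or_lt1 [simp]: "t \<in> W \<Longrightarrow>
    sem W L t (now_or_lt1 \<psi>) \<longleftrightarrow> (\<exists>t' \<in> W. t \<le> t' \<and> t' < t + 1 \<and> sem W L t' \<psi>)"
  by (fastforce simp: now_or_lt1_def le_less)

lemma sem_conj [simp]: "sem W L t (conj \<psi>s) \<longleftrightarrow> (\<forall>\<psi> \<in> set \<psi>s. sem W L t \<psi>)"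
  by (induction \<psi>s) auto

lemma sem_disj [simp]: "sem W L t (disj \<psi>s) \<longleftrightarrow> (\<exists>\<psi> \<in> set \<psi>s. sem W L t \<psi>)"
  by (auto simp: disj_def)

text \<open>Each \<open>nxt\<close> leaves exactly one event behind, hence the count over a
  half-open range. In this form a numeral is read off the last row.\<close>

lemma sem_nth_next:
  assumes "finite W" "t \<in> W"
  shows "sem W L t (nth_next n \<psi>) \<longleftrightarrow>
    (\<exists>q \<in> W. t \<le> q \<and> card {w \<in> W. t \<le> w \<and> w < q} = n \<and> sem W L q \<psi>)"
  using assms(2)
proof (induction n arbitrary: t)
  case 0
  have "{w \<in> W. t \<le> w \<and> w < q} = {} \<longleftrightarrow> q = t" if "t \<le> q" for q
    using that 0 by force
  then show ?case using 0 assms(1) by auto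
next
  case (Suc n)
  have next_card: "card {w \<in> W. t \<le> w \<and> w < q} = Suc (card {w \<in> W. t' \<le> w \<and> w < q})"
    if "t' \<in> W" "t < t'" "\<forall>s \<in> W. t < s \<longrightarrow> t' \<le> s" "t' \<le> q" for t' q
  proof -
    have "{w \<in> W. t \<le> w \<and> w < q} = insert t {w \<in> W. t' \<le> w \<and> w < q}"
      using that Suc.prems by (auto simp: le_less)
    then show ?thesis using that assms(1) by simp
  qed
  show ?case
  proof
    assume "sem W L t (nth_next (Suc n) \<psi>)"
    then obtain t' where t': "t' \<in> W" "t < t'" "\<forall>s \<in> W. t < s \<longrightarrow> t' \<le> s" "sem W L t' (nth_next n \<psi>)"
      by auto
    then obtain q where "q \<in> W" "t' \<le> q" "card {w \<in> W. t' \<le> w \<and> w < q} = n" "sem W L q \<psi>"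
      using Suc.IH by auto
    then show "\<exists>q \<in> W. t \<le> q \<and> card {w \<in> W. t \<le> w \<and> w < q} = Suc n \<and> sem W L q \<psi>"
      using next_card[OF t'(1-3)] t'(2) by (intro bexI[of _ q]) auto
  next
    assume "\<exists>q \<in> W. t \<le> q \<and> card {w \<in> W. t \<le> w \<and> w < q} = Suc n \<and> sem W L q \<psi>"
    then obtain q where q: "q \<in> W" "t \<le> q" "card {w \<in> W. t \<le> w \<and> w < q} = Suc n" "sem W L q \<psi>"
      by auto
    have "t \<noteq> q"
    proof
      assume "t = q"
      then have "{w \<in> W. t \<le> w \<and> w < q} = {}" by auto
      then show False using q(3) by (simp only: card.empty)
    qed
    then have "t < q" using q(2) by simp
    let ?t = "Min {w \<in> W. t < w}"
    have t: "?t \<in> {w \<in> W. t < w}" using assms(1) q(1) \<open>t < q\<close> by (intro Min_in) auto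
    have min: "?t \<le> s" if "s \<in> W" "t < s" for s using that assms(1) by (intro Min_le) auto
    then have "card {w \<in> W. ?t \<le> w \<and> w < q} = n"
      using next_card[of ?t q] q \<open>t < q\<close> t by auto
    then have "sem W L ?t (nth_next n \<psi>)"
      using t q min[OF q(1) \<open>t < q\<close>] by (subst Suc.IH) auto
    then show "sem W L t (nth_next (Suc n) \<psi>)" using t min by auto
  qed
qed

context
  fixes p :: nat
begin

text \<open>Existentially quantified traces have even numbers, universally quantified ones odd numbers.
  There are three input traces, \<open>a < 3\<close>; trace \<open>0\<close> marks the start of the last row.\<close>

definition tr_input :: "nat \<Rightarrow> mtl" where "tr_input a = PropV p (2 * a)"
definition tr_rule :: "nat \<Rightarrow> mtl" where "tr_rule n = PropV p (6 + 4 * n)"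
definition tr_var :: "nat \<Rightarrow> mtl" where "tr_var i = PropV p (8 + 4 * i)"
definition tr_mark :: mtl where "tr_mark = PropV p 1"
definition tr_col :: "nat \<Rightarrow> mtl" where "tr_col i = PropV p (2 * i + 3)"

text \<open>The last row becomes a window of length 1 with nothing behind it, so its events lie in
  distinct columns and \<open>nxt\<close> acts there as the successor.\<close>

definition last_row :: mtl where
  "last_row = imp (tr_input 0) (Neg (ev_ge1 Top))"

definition input_unique :: "nat \<Rightarrow> mtl" where
  "input_unique a = imp (tr_input a) (Neg (ev (tr_input a)))"

text \<open>The universal trace is instantiated with all events at distance at least 1; the formula
  then says that the first of them is at distance exactly 1.\<close>

definition grid :: mtl where
  "grid = imp (ev (tr_input 0))
     (imp (And (Neg (ev_lt1 tr_mark)) (Neg (ev_ge1 (Neg tr_mark)))) (ev_le1 tr_mark))"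

text \<open>The condition \<open>ev (tr_input 0)\<close> exempts the last row, whose events have no
  copies at distance 1.\<close>

definition col_step :: "nat \<Rightarrow> mtl" where
  "col_step i = imp (And (tr_col i) (ev (tr_input 0)))
     (And (Neg (ev_lt1 (tr_col i))) (ev_le1 (tr_col i)))"

text \<open>This constrains a universal trace and so occurs only as an assumption. The first
  conjunct anchors the trace at an event for variable \<open>i\<close> in the current row.\<close>

definition column :: "nat \<Rightarrow> mtl" where
  "column i = And (now_or_lt1 (And (tr_col i) (tr_var i))) (And (col_step i) (alw (col_step i)))"

text \<open>A variable may occur repeatedly in the head; all its occurrences are compared at the same event,
  since nothing forces the row to have only one event for it.\<close>

definition fact_row :: "sym rule list \<Rightarrow> sym \<times> nat list \<Rightarrow> nat \<Rightarrow> mtl" where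
  "fact_row P f n = conj (tr_rule n # map (\<lambda>h. now_or_lt1
     (conj (tr_var h # map (\<lambda>(z, _). tr_col z) (filter (\<lambda>(_, h'). h' = h) (zip (snd f) (head_args (P ! n)))))))
     (head_args (P ! n)))"

definition matching :: "sym rule list \<Rightarrow> sym \<times> nat list \<Rightarrow> nat list" where
  "matching P f = filter (\<lambda>n. head_sym (P ! n) = fst f \<and> length (head_args (P ! n)) = length (snd f))
     [0..<length P]"

text \<open>Inputs and successors are tested in the last row, the only one guaranteed to have an
  event for every column. Body facts are sought in any later row with a suitable head.\<close>

definition premise_formulas :: "sym rule list \<Rightarrow> sym rule \<Rightarrow> mtl list" where
  "premise_formulas P R =
     map (\<lambda>(a, i). ev (And (tr_input 0) (now_or_lt1 (And (tr_col i) (tr_input a))))) (inputs R)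
   @ map (\<lambda>(i, j). ev (And (tr_input 0) (now_or_lt1 (And (tr_col i) (nxt (tr_col j)))))) (succs R)
   @ map (\<lambda>f. ev (disj (map (fact_row P f) (matching P f)))) (body R)"

text \<open>The events for the variables are demanded outside the implication: if one were missing,
  its \<open>column\<close> would be false under every universal choice, and the row would claim its
  head without premises.\<close>

definition rule_row :: "sym rule list \<Rightarrow> nat \<Rightarrow> nat \<Rightarrow> mtl" where
  "rule_row P m n = imp (tr_rule n)
     (And (conj (map (\<lambda>i. now_or_lt1 (tr_var i)) [0..<m]))
       (imp (conj (map column [0..<m])) (conj (premise_formulas P (P ! n)))))"

text \<open>The row demanded for rule 0 makes the head of the first rule the fact to be
  derived.\<close>

definition program_formula :: "sym rule list \<Rightarrow> nat \<Rightarrow> mtl" where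
  "program_formula P m = And (ev (tr_input 0)) (And (ev (tr_rule 0))
     (alw (conj (last_row # grid # map input_unique [0..<3] @ map (rule_row P m) [0..<length P]))))"

definition input_formula :: "nat \<Rightarrow> nat \<Rightarrow> mtl" where
  "input_formula n a = ev (And (tr_input 0) (nth_next n (tr_input a)))"

definition encoding :: "mtl \<Rightarrow> nat \<Rightarrow> nat \<Rightarrow> mtl" where
  "encoding \<psi> n1 n2 = And \<psi> (And (input_formula n1 1) (input_formula n2 2))"

section \<open>Truth conditions of the row formulas\<close>

lemma sem_tr [simp]:
  "sem W (interleave E C) t (tr_input a) \<longleftrightarrow> t \<in> E (2 * a)"
  "sem W (interleave E C) t (tr_rule n) \<longleftrightarrow> t \<in> E (6 + 4 * n)"
  "sem W (interleave E C) t (tr_var i) \<longleftrightarrow> t \<in> E (8 + 4 * i)"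
  "sem W (interleave E C) t tr_mark \<longleftrightarrow> t \<in> C 1"
  "sem W (interleave E C) t (tr_col i) \<longleftrightarrow> t \<in> C (2 * i + 3)"
  by (simp_all add: tr_input_def tr_rule_def tr_var_def tr_mark_def tr_col_def interleave_def)

lemma sem_column: "t \<in> W \<Longrightarrow> sem W (interleave E C) t (column i) \<longleftrightarrow>
   (\<exists>t' \<in> W. t \<le> t' \<and> t' < t + 1 \<and> t' \<in> C (2 * i + 3) \<and> t' \<in> E (8 + 4 * i)) \<and>
   (\<forall>c \<in> W. t \<le> c \<longrightarrow> c \<in> C (2 * i + 3) \<and> (\<exists>s \<in> W. c < s \<and> s \<in> E 0) \<longrightarrow>
      \<not> (\<exists>s \<in> W. c < s \<and> s < c + 1 \<and> s \<in> C (2 * i + 3)) \<and>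
      (\<exists>s \<in> W. c < s \<and> s \<le> c + 1 \<and> s \<in> C (2 * i + 3)))"
proof -
  have * : "sem W L t \<psi> \<and> sem W L t (alw \<psi>) \<longleftrightarrow> (\<forall>c \<in> W. t \<le> c \<longrightarrow> sem W L c \<psi>)"
    if "t \<in> W" for L \<psi>
    using that by (auto simp: le_less)
  assume "t \<in> W"
  then show ?thesis
    unfolding column_def sem.simps(4) *[OF \<open>t \<in> W\<close>] by (simp add: col_step_def)
qed

lemma sem_fact_row: "t \<in> W \<Longrightarrow> sem W (interleave E C) t (fact_row P f n) \<longleftrightarrow>
   t \<in> E (6 + 4 * n) \<and> (\<forall>h \<in> set (head_args (P ! n)). \<exists>t' \<in> W. t \<le> t' \<and> t' < t + 1 \<and>
     t' \<in> E (8 + 4 * h) \<and>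
     (\<forall>z. (z, h) \<in> set (zip (snd f) (head_args (P ! n))) \<longrightarrow> t' \<in> C (2 * z + 3)))"
  by (auto simp: fact_row_def)

lemma sem_input_premise: "sem W (interleave E C) t
     (ev (And (tr_input 0) (now_or_lt1 (And (tr_col i) (tr_input a))))) \<longleftrightarrow>
   (\<exists>l \<in> W. t < l \<and> l \<in> E 0 \<and>
      (\<exists>t' \<in> W. l \<le> t' \<and> t' < l + 1 \<and> t' \<in> C (2 * i + 3) \<and> t' \<in> E (2 * a)))"
  unfolding sem_ev by (intro bex_cong refl) simp

lemma sem_succ_premise: "sem W (interleave E C) t
     (ev (And (tr_input 0) (now_or_lt1 (And (tr_col i) (nxt (tr_col j)))))) \<longleftrightarrow>
   (\<exists>l \<in> W. t < l \<and> l \<in> E 0 \<and> (\<exists>t' \<in> W. l \<le> t' \<and> t' < l + 1 \<and> t' \<in> C (2 * i + 3) \<and>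
      (\<exists>s \<in> W. t' < s \<and> (\<forall>w \<in> W. t' < w \<longrightarrow> s \<le> w) \<and> s \<in> C (2 * j + 3))))"
  unfolding sem_ev by (intro bex_cong refl) simp

lemma sem_body_premise: "sem W (interleave E C) t (ev (disj (map (fact_row P f) (matching P f)))) \<longleftrightarrow>
   (\<exists>t' \<in> W. t < t' \<and> (\<exists>n' \<in> set (matching P f). sem W (interleave E C) t' (fact_row P f n')))"
  by simp

lemma sem_premises: "sem W L t (conj (premise_formulas P R)) \<longleftrightarrow>
   (\<forall>(a, i) \<in> set (inputs R).
      sem W L t (ev (And (tr_input 0) (now_or_lt1 (And (tr_col i) (tr_input a)))))) \<and>
   (\<forall>(i, j) \<in> set (succs R).
      sem W L t (ev (And (tr_input 0) (now_or_lt1 (And (tr_col i) (nxt (tr_col j))))))) \<and>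
   (\<forall>f \<in> set (body R). sem W L t (ev (disj (map (fact_row P f) (matching P f)))))"
  unfolding sem_conj premise_formulas_def set_append ball_Un set_map by (simp only: ball_simps split_def)

lemma sem_rule_row: "t \<in> W \<Longrightarrow> sem W (interleave E C) t (rule_row P m n) \<longleftrightarrow>
   (t \<in> E (6 + 4 * n) \<longrightarrow>
     (\<forall>i \<in> {..<m}. \<exists>t' \<in> W. t \<le> t' \<and> t' < t + 1 \<and> t' \<in> E (8 + 4 * i)) \<and>
     ((\<forall>i \<in> {..<m}. sem W (interleave E C) t (column i)) \<longrightarrow>
      sem W (interleave E C) t (conj (premise_formulas P (P ! n)))))"
  unfolding rule_row_def sem_imp sem.simps(4) sem_conj[of _ _ _ "map column [0..<m]"]
    sem_conj[of _ _ _ "map (\<lambda>i. now_or_lt1 (tr_var i)) [0..<m]"]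
  by (simp del: sem_conj add: atLeast0LessThan)

section \<open>Soundness: from satisfying sets to a derivation\<close>

definition rule_bounded :: "nat \<Rightarrow> sym rule \<Rightarrow> bool" where
  "rule_bounded m R \<longleftrightarrow> set (head_args R) \<subseteq> {..<m} \<and>
     (\<forall>(a, i) \<in> set (inputs R). a < 3 \<and> i < m) \<and> (\<forall>(i, j) \<in> set (succs R). i < m \<and> j < m) \<and>
     (\<forall>(q, zs) \<in> set (body R). set zs \<subseteq> {..<m})"

text \<open>Input 0 is the constant zero, since its trace marks the start of the last row and thus
  the first column.\<close>

definition input_val :: "nat \<Rightarrow> nat \<Rightarrow> nat \<Rightarrow> nat" where
  "input_val n1 n2 a = (if a = 1 then n1 else if a = 2 then n2 else 0)"

lemma encoding_sound:
  assumes "finite W" and bounded: "\<And>R. R \<in> set P \<Longrightarrow> rule_bounded m R" and "P \<noteq> []"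
    and sat: "\<And>C. sem W (interleave E C) 0 (encoding (program_formula P m) n1 n2)"
  shows "\<exists>ws. derivable P (input_val n1 n2) (head_sym (P ! 0)) ws"
proof -
  let ?\<nu> = "input_val n1 n2"
  have ev_input: "\<exists>l \<in> W. 0 < l \<and> l \<in> E 0" and ev_rule: "\<exists>b \<in> W. 0 < b \<and> b \<in> E 6"
    using sat[of "\<lambda>_. {}"] by (auto simp: encoding_def program_formula_def)
  have always: "sem W (interleave E C) t last_row" "sem W (interleave E C) t grid"
    "a < 3 \<Longrightarrow> sem W (interleave E C) t (input_unique a)"
    "n < length P \<Longrightarrow> sem W (interleave E C) t (rule_row P m n)"
    if "t \<in> W" "0 < t" for C t a n
    using sat[of C] that by (auto simp: encoding_def program_formula_def)
  obtain l where l: "l \<in> W" "0 < l" "l \<in> E 0" using ev_input by auto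
  have unique: "t = t'" if "a < 3" "t \<in> W" "t' \<in> W" "0 < t" "0 < t'" "t \<in> E (2 * a)" "t' \<in> E (2 * a)"
    for t t' a
    using always(3)[of t a "\<lambda>_. {}"] always(3)[of t' a "\<lambda>_. {}"] that
    by (cases t t' rule: linorder_cases) (auto simp: input_unique_def)
  have only_l: "t = l" if "t \<in> W" "0 < t" "t \<in> E 0" for t
    using unique[of 0 t l] that l by simp
  have last: "t < l + 1" if "t \<in> W" for t
    using always(1)[of l "\<lambda>_. {}"] l that by (auto simp: last_row_def not_le)
  have shift: "t + 1 \<in> W" if "t \<in> W" "0 < t" "t < l" for t
    using always(2)[of t "\<lambda>_. {w. t + 1 \<le> w}"] that l by (auto simp: grid_def)
  \<comment> \<open>the number of the column of \<open>e\<close>, counted in the last row\<close>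
  define val where "val e = card {w \<in> W. l \<le> w \<and> w < l + frac (e - l)}" for e
  have val_cong: "val e = val e'" if "e - e' \<in> \<int>" for e e'
  proof -
    have "frac (e - l) = frac (e' - l)"
      using frac_add_int_right[OF that, of "e' - l"] by simp
    then show ?thesis by (simp add: val_def)
  qed
  have val_last: "val q = card {w \<in> W. l \<le> w \<and> w < q}" if "q \<in> W" "l \<le> q" for q
    using last[OF that(1)] that(2) by (simp add: val_def frac_eq[THEN iffD2])
  have input: "\<exists>q \<in> W. l \<le> q \<and> val q = ?\<nu> a \<and> q \<in> E (2 * a)" if "a < 3" for a
  proof (cases "a = 0")
    case True
    have "{w \<in> W. l \<le> w \<and> w < l} = {}" by auto
    then have "val l = 0" using val_last[of l] l by (simp only: card.empty order_refl)
    then show ?thesis using l True by (auto simp: input_val_def intro!: bexI[of _ l])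
  next
    case False
    then have "a = 1 \<or> a = 2" using that by auto
    then have "sem W (interleave E (\<lambda>_. {})) 0 (input_formula (?\<nu> a) a)"
      using sat[of "\<lambda>_. {}"] by (auto simp: encoding_def input_val_def)
    then obtain t where "t \<in> W" "0 < t" "t \<in> E 0"
      "sem W (interleave E (\<lambda>_. {})) t (nth_next (?\<nu> a) (tr_input a))"
      by (auto simp: input_formula_def)
    with only_l[of t] show ?thesis
      by (auto simp: sem_nth_next[OF assms(1)] val_last)
  qed
  \<comment> \<open>A row may contain several events for one variable. The claim therefore covers
    every choice \<open>e\<close> of one event each; for a row used as a premise, the choice is
    dictated by matching its head.\<close>
  have claim: "derivable P ?\<nu> (head_sym (P ! n)) (map (val \<circ> e) (head_args (P ! n)))"
    if "b \<in> W" "0 < b" "n < length P" "b \<in> E (6 + 4 * n)"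
      "\<And>i. i < m \<Longrightarrow> e i \<in> W \<and> b \<le> e i \<and> e i < b + 1 \<and> e i \<in> E (8 + 4 * i)" for b n e
    using that
  \<comment> \<open>Rows used as premises start strictly later, so fewer events follow them.\<close>
  proof (induction "card {w \<in> W. b < w}" arbitrary: b n e rule: less_induct)
    case less
    \<comment> \<open>The true columns: all events at integer distance from the chosen one. The
      index inverts the numbering \<open>2 * i + 3\<close> of \<open>tr_col i\<close>.\<close>
    define C where "C x = {w \<in> W. w - e ((x - 3) div 2) \<in> \<int>}" for x
    have C: "C (2 * i + 3) = {w \<in> W. w - e i \<in> \<int>}" for i by (simp add: C_def)
    have valC: "val c = val (e i)" if "c \<in> C (2 * i + 3)" for c i
      using that by (intro val_cong) (simp add: C)
    have "sem W (interleave E C) b (column i)" if "i < m" for i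
    proof -
      have "c + 1 \<in> C (2 * i + 3)" "\<forall>s \<in> W. c < s \<and> s < c + 1 \<longrightarrow> s \<notin> C (2 * i + 3)"
        if c: "c \<in> C (2 * i + 3)" "b \<le> c" "s \<in> W" "c < s" "s \<in> E 0" for c s
      proof -
        have "c < l" using only_l[of s] c less.prems(2) by simp
        then have "c + 1 \<in> W" using shift[of c] c less.prems(2) by (simp add: C)
        moreover have ci: "c - e i \<in> \<int>" using c(1) by (simp add: C)
        then have "(c - e i) + 1 \<in> \<int>" by simp
        then have "c + 1 - e i \<in> \<int>" by (simp add: algebra_simps)
        ultimately show "c + 1 \<in> C (2 * i + 3)" by (simp add: C)
        have "w \<le> c \<or> c + 1 \<le> w" if "w - e i \<in> \<int>" for w
        proof -
          have "w - c \<in> \<int>" using Ints_diff[OF that ci] by simp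
          then obtain k where k: "w - c = of_int k" by (auto elim: Ints_cases)
          then have "of_int k \<le> (0::real) \<or> (1::real) \<le> of_int k"
            by (simp only: of_int_le_0_iff of_int_1_le_iff) linarith
          then show ?thesis using k by linarith
        qed
        then show "\<forall>s \<in> W. c < s \<and> s < c + 1 \<longrightarrow> s \<notin> C (2 * i + 3)"
          by (fastforce simp: C)
      qed
      note * = this
      have "\<exists>s \<in> W. c < s \<and> s \<le> c + 1 \<and> s \<in> C (2 * i + 3)"
        if c: "c \<in> C (2 * i + 3)" "b \<le> c" "s \<in> W" "c < s" "s \<in> E 0" for c s
        using *(1)[OF that] by (intro bexI[of _ "c + 1"]) (auto simp: C)
      moreover have "\<exists>t' \<in> W. b \<le> t' \<and> t' < b + 1 \<and> t' \<in> C (2 * i + 3) \<and> t' \<in> E (8 + 4 * i)"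
        using less.prems(5)[OF that] by (intro bexI[of _ "e i"]) (auto simp: C)
      ultimately show ?thesis
        using *(2) unfolding sem_column[OF less.prems(1)] by blast
    qed
    then have prem: "sem W (interleave E C) b (conj (premise_formulas P (P ! n)))"
      using always(4)[OF less.prems(1,2,3), of C] less.prems(4)
      unfolding sem_rule_row[OF less.prems(1)] by simp
    have R: "P ! n \<in> set P" using less.prems(3) by simp
    show ?case
      unfolding map_map[symmetric] comp_def
    proof (rule derivableI[OF R])
      show "\<forall>(a, i) \<in> set (inputs (P ! n)). val (e i) = ?\<nu> a"
      proof (clarify)
        fix a i assume ai: "(a, i) \<in> set (inputs (P ! n))"
        then have "a < 3" using bounded[OF R] by (auto simp: rule_bounded_def)
        have "sem W (interleave E C) b (ev (And (tr_input 0) (now_or_lt1 (And (tr_col i) (tr_input a)))))"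
          using prem ai unfolding sem_premises by auto
        then obtain l' t where t: "l' \<in> W" "b < l'" "l' \<in> E 0" "t \<in> W" "l' \<le> t" "t \<in> C (2 * i + 3)" "t \<in> E (2 * a)"
          unfolding sem_input_premise by blast
        obtain q where q: "q \<in> W" "l \<le> q" "val q = ?\<nu> a" "q \<in> E (2 * a)"
          using input[OF \<open>a < 3\<close>] by auto
        have "t = q" using unique[OF \<open>a < 3\<close>, of t q] t q l less.prems(2) by simp
        then show "val (e i) = ?\<nu> a" using q valC[OF t(6)] by simp
      qed
      show "\<forall>(i, j) \<in> set (succs (P ! n)). val (e j) = Suc (val (e i))"
      proof (clarify)
        fix i j assume ij: "(i, j) \<in> set (succs (P ! n))"
        have "sem W (interleave E C) b
            (ev (And (tr_input 0) (now_or_lt1 (And (tr_col i) (nxt (tr_col j))))))"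
          using prem ij unfolding sem_premises by auto
        then obtain l' t s where t: "l' \<in> W" "b < l'" "l' \<in> E 0" "t \<in> W" "l' \<le> t" "t \<in> C (2 * i + 3)"
          "s \<in> W" "t < s" "\<And>w. w \<in> W \<Longrightarrow> t < w \<Longrightarrow> s \<le> w" "s \<in> C (2 * j + 3)"
          unfolding sem_succ_premise by blast
        have "l' = l" using only_l t less.prems(2) by simp
        then have "{w \<in> W. l \<le> w \<and> w < s} = insert t {w \<in> W. l \<le> w \<and> w < t}"
          using t(4,5,7,8,9) by (auto simp: not_less[symmetric]) (metis less_le_not_le less_linear)
        then have "val s = Suc (val t)"
          using t \<open>l' = l\<close> assms(1) by (simp add: val_last)
        then show "val (e j) = Suc (val (e i))" using valC t by metis
      qed
      show "\<forall>(q, zs) \<in> set (body (P ! n)). derivable P ?\<nu> q (map (\<lambda>i. val (e i)) zs)"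
      proof (clarify)
        fix q zs assume qzs: "(q, zs) \<in> set (body (P ! n))"
        then have "sem W (interleave E C) b (ev (disj (map (fact_row P (q, zs)) (matching P (q, zs)))))"
          using prem unfolding sem_premises by blast
        then obtain b' n' where b': "b' \<in> W" "b < b'" and n': "n' \<in> set (matching P (q, zs))"
          and row: "sem W (interleave E C) b' (fact_row P (q, zs) n')"
          unfolding sem_body_premise by blast
        let ?hs = "head_args (P ! n')"
        have len: "length ?hs = length zs" and q: "q = head_sym (P ! n')" and "n' < length P"
          using n' by (auto simp: matching_def)
        have hs: "set ?hs \<subseteq> {..<m}"
          using bounded[of "P ! n'"] \<open>n' < length P\<close> by (auto simp: rule_bounded_def)
        have pos: "b' > 0" using less.prems(2) b' by simp
        \<comment> \<open>Head variables get the event found by matching. The other variables of the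
          later rule are constrained only by its own \<open>rule_row\<close>, which supplies some
          event for each.\<close>
        have "\<exists>t \<in> W. b' \<le> t \<and> t < b' + 1 \<and> t \<in> E (8 + 4 * h) \<and>
            (\<forall>z. (z, h) \<in> set (zip zs ?hs) \<longrightarrow> t \<in> C (2 * z + 3))" if "h < m" for h
        proof (cases "h \<in> set ?hs")
          case True
          then show ?thesis using row unfolding sem_fact_row[OF b'(1)] by simp
        next
          case False
          then have "(z, h) \<notin> set (zip zs ?hs)" for z by (auto dest: set_zip_rightD)
          moreover have "b' \<in> E (6 + 4 * n')" using row unfolding sem_fact_row[OF b'(1)] by simp
          ultimately show ?thesis
            using always(4)[OF b'(1) pos \<open>n' < length P\<close>] that
            unfolding sem_rule_row[OF b'(1)] by simp
        qed
        then obtain e' where e': "\<And>h. h < m \<Longrightarrow> e' h \<in> W \<and> b' \<le> e' h \<and> e' h < b' + 1 \<and>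
            e' h \<in> E (8 + 4 * h)"
            "\<And>h z. h < m \<Longrightarrow> (z, h) \<in> set (zip zs ?hs) \<Longrightarrow> e' h \<in> C (2 * z + 3)"
          by metis
        have "card {w \<in> W. b' < w} < card {w \<in> W. b < w}"
          using b' assms(1) by (intro psubset_card_mono) auto
        moreover have "b' \<in> E (6 + 4 * n')" using row unfolding sem_fact_row[OF b'(1)] by simp
        ultimately have "derivable P ?\<nu> q (map (val \<circ> e') ?hs)"
          unfolding q using b' pos \<open>n' < length P\<close> e'(1) by (intro less.hyps) auto
        moreover have "map (val \<circ> e') ?hs = map (\<lambda>i. val (e i)) zs"
        proof (rule nth_equalityI)
          fix i assume i: "i < length (map (val \<circ> e') ?hs)"
          then have "(zs ! i, ?hs ! i) \<in> set (zip zs ?hs)" using len by (auto simp: set_zip)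
          moreover have "?hs ! i < m" using hs i nth_mem by fastforce
          ultimately have "val (e' (?hs ! i)) = val (e (zs ! i))" using e'(2) valC by blast
          then show "map (val \<circ> e') ?hs ! i = map (\<lambda>i. val (e i)) zs ! i" using i len by simp
        qed (simp add: len)
        ultimately show "derivable P ?\<nu> q (map (\<lambda>i. val (e i)) zs)" by simp
      qed
    qed
  qed
  obtain b where b: "b \<in> W" "0 < b" "b \<in> E 6" using ev_rule by auto
  have "0 < length P" using assms(3) by simp
  then have "\<forall>i < m. \<exists>t \<in> W. b \<le> t \<and> t < b + 1 \<and> t \<in> E (8 + 4 * i)"
    using always(4)[OF b(1,2), of 0 "\<lambda>_. {}"] b(3) unfolding sem_rule_row[OF b(1)] by simp
  then obtain e where "\<And>i. i < m \<Longrightarrow> e i \<in> W \<and> b \<le> e i \<and> e i < b + 1 \<and> e i \<in> E (8 + 4 * i)"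
    by metis
  then show ?thesis using claim[OF b(1,2) \<open>0 < length P\<close>, of e] b(3) by auto
qed

section \<open>Completeness: from a derivation to satisfying sets\<close>

definition proves :: "sym rule list \<Rightarrow> nat \<times> (nat \<Rightarrow> nat) \<Rightarrow> sym \<Rightarrow> nat list \<Rightarrow> bool" where
  "proves P d q ws \<longleftrightarrow> fst d < length P \<and> head_sym (P ! fst d) = q \<and>
     map (snd d) (head_args (P ! fst d)) = ws"

definition instance_ok :: "sym rule list \<Rightarrow> (nat \<Rightarrow> nat) \<Rightarrow> nat \<times> (nat \<Rightarrow> nat) \<Rightarrow>
    (nat \<times> (nat \<Rightarrow> nat)) list \<Rightarrow> bool" where
  "instance_ok P \<nu> d ds \<longleftrightarrow> fst d < length P \<and>
     (\<forall>(a, i) \<in> set (inputs (P ! fst d)). snd d i = \<nu> a) \<and>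
     (\<forall>(i, j) \<in> set (succs (P ! fst d)). snd d j = Suc (snd d i)) \<and>
     (\<forall>(q, zs) \<in> set (body (P ! fst d)). \<exists>d' \<in> set ds. proves P d' q (map (snd d) zs))"

text \<open>A derivation tree flattened so that every instance relies only on later entries; the
  order of the list becomes the order of the rows in time.\<close>

primrec justified :: "sym rule list \<Rightarrow> (nat \<Rightarrow> nat) \<Rightarrow> (nat \<times> (nat \<Rightarrow> nat)) list \<Rightarrow> bool" where
  "justified P \<nu> [] = True"
| "justified P \<nu> (d # ds) = (instance_ok P \<nu> d ds \<and> justified P \<nu> ds)"

lemma instance_ok_mono: "instance_ok P \<nu> d ds \<Longrightarrow> set ds \<subseteq> set ds' \<Longrightarrow> instance_ok P \<nu> d ds'"
  unfolding instance_ok_def by blast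

lemma justified_append: "justified P \<nu> ds \<Longrightarrow> justified P \<nu> ds' \<Longrightarrow> justified P \<nu> (ds @ ds')"
  by (induction ds) (auto elim: instance_ok_mono)

lemma justified_nth: "justified P \<nu> ds \<Longrightarrow> r < length ds \<Longrightarrow> instance_ok P \<nu> (ds ! r) (drop (Suc r) ds)"
  by (induction ds arbitrary: r) (auto simp: nth_Cons split: nat.split)

lemma justified_if_derivable:
  assumes "derivable P \<nu> q ws"
  shows "\<exists>ds. justified P \<nu> ds \<and> (\<exists>d \<in> set ds. proves P d q ws)"
  using assms
proof (induction rule: derivable.induct)
  case (derivableI R \<sigma>)
  have "\<exists>ds. justified P \<nu> ds \<and> (\<forall>(q, zs) \<in> set fs. \<exists>d \<in> set ds. proves P d q (map \<sigma> zs))"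
    if "set fs \<subseteq> set (body R)" for fs
    using that
  proof (induction fs)
    case Nil
    show ?case by (intro exI[of _ "[]"]) simp
  next
    case (Cons f fs)
    then obtain ds where ds: "justified P \<nu> ds"
      "\<forall>(q, zs) \<in> set fs. \<exists>d \<in> set ds. proves P d q (map \<sigma> zs)" by auto
    obtain q zs where f: "f = (q, zs)" by (cases f)
    with Cons.prems derivableI.IH obtain ds' where ds': "justified P \<nu> ds'"
      "\<exists>d \<in> set ds'. proves P d q (map \<sigma> zs)" by fastforce
    show ?case
      using justified_append[OF ds(1) ds'(1)] ds(2) ds'(2) unfolding f
      by (intro exI[of _ "ds @ ds'"]) fastforce
  qed
  then obtain ds where ds: "justified P \<nu> ds"
    "\<forall>(q, zs) \<in> set (body R). \<exists>d \<in> set ds. proves P d q (map \<sigma> zs)" by blast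
  obtain n where n: "n < length P" "P ! n = R" using derivableI.hyps(1) by (auto simp: in_set_conv_nth)
  have "instance_ok P \<nu> (n, \<sigma>) ds"
    using n derivableI.hyps(2,3) ds(2) by (auto simp: instance_ok_def)
  moreover have "proves P (n, \<sigma>) (head_sym R) (map \<sigma> (head_args R))"
    using n by (simp add: proves_def)
  ultimately show ?case using ds(1) by (intro exI[of _ "(n, \<sigma>) # ds"]) auto
qed

text \<open>The offset 1 keeps all events positive, because \<open>ev\<close> and \<open>alw\<close>
  evaluated at time 0 look strictly into the future.\<close>

definition grid_time :: "nat \<Rightarrow> nat \<Rightarrow> nat \<Rightarrow> real" where
  "grid_time N r c = 1 + real r + real c / real N"

lemma grid_time_Suc: "grid_time N (Suc r) c = grid_time N r c + 1"
  by (simp add: grid_time_def)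

lemma grid_time_pos: "0 < grid_time N r c"
  by (simp add: grid_time_def add_pos_nonneg)

lemma grid_time_less_iff:
  assumes "c < N" "c' < N"
  shows "grid_time N r c < grid_time N r' c' \<longleftrightarrow> r < r' \<or> r = r' \<and> c < c'"
proof -
  have x: "0 \<le> real c / real N" "real c / real N < 1" "0 \<le> real c' / real N" "real c' / real N < 1"
    using assms by (auto simp: divide_simps)
  consider "r < r'" | "r = r'" | "r' < r" by linarith
  then show ?thesis
  proof cases
    case 1
    then have "real r + 1 \<le> real r'" by simp
    then show ?thesis using 1 x unfolding grid_time_def by linarith
  next
    case 2
    then show ?thesis using assms by (simp add: grid_time_def divide_less_cancel)
  next
    case 3
    then have "real r' + 1 \<le> real r" by simp
    then show ?thesis using 3 x unfolding grid_time_def by linarith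
  qed
qed

lemma grid_time_le_iff:
  assumes "c < N" "c' < N"
  shows "grid_time N r c \<le> grid_time N r' c' \<longleftrightarrow> r < r' \<or> r = r' \<and> c \<le> c'"
  using grid_time_less_iff[OF assms(2,1), of r' r] by (auto simp: not_less[symmetric])

lemma grid_time_eq_iff:
  assumes "c < N" "c' < N"
  shows "grid_time N r c = grid_time N r' c' \<longleftrightarrow> r = r' \<and> c = c'"
  unfolding order.eq_iff[of "grid_time N r c"]
  using grid_time_le_iff[OF assms, of r r'] grid_time_le_iff[OF assms(2,1), of r' r] by auto

text \<open>Row \<open>r\<close> carries the instance \<open>ds ! r\<close>, and one more row,
  numbered \<open>length ds\<close>, is the last row. All rows contain all columns.\<close>

lemma encoding_complete:
  assumes bounded: "\<And>R. R \<in> set P \<Longrightarrow> rule_bounded m R"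
    and just: "justified P (input_val n1 n2) ds" and goal: "d0 \<in> set ds" "fst d0 = 0"
  obtains W E where "finite W" "W \<subseteq> {0..}"
    "\<And>C. sem W (interleave E C) 0 (encoding (program_formula P m) n1 n2)"
proof -
  let ?\<nu> = "input_val n1 n2"
  define K where "K = length ds"
  define \<sigma> where "\<sigma> r = snd (ds ! r)" for r
  have "finite ((\<lambda>(r, i). \<sigma> r i) ` ({..<K} \<times> {..<m}) \<union> {n1, n2})" by simp
  \<comment> \<open>The number of columns exceeds both inputs and every value of a variable below
    \<open>m\<close>, so each of these numbers has a column.\<close>
  then obtain N where N: "\<forall>v \<in> (\<lambda>(r, i). \<sigma> r i) ` ({..<K} \<times> {..<m}) \<union> {n1, n2}. v < N"
    unfolding finite_nat_set_iff_bounded by blast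
  have \<sigma>N: "\<sigma> r i < N" if "r < K" "i < m" for r i using N that by auto
  have \<nu>N: "?\<nu> a < N" for a using N by (auto simp: input_val_def)
  have N0: "0 < N" using \<nu>N[of 0] by simp
  define g where "g = grid_time N"
  note less = grid_time_less_iff[of _ N, folded g_def]
    and le = grid_time_le_iff[of _ N, folded g_def]
    and eq = grid_time_eq_iff[of _ N, folded g_def]
  have Suc_g: "g r c + 1 = g (Suc r) c" for r c by (simp add: g_def grid_time_Suc)
  have pos: "0 < g r c" for r c by (simp add: g_def grid_time_pos)
  define W where "W = (\<lambda>(r, c). g r c) ` ({..K} \<times> {..<N})"
  have W: "w \<in> W \<longleftrightarrow> (\<exists>r c. r \<le> K \<and> c < N \<and> w = g r c)" for w by (auto simp: W_def)
  have gW: "g r c \<in> W" if "r \<le> K" "c < N" for r c using that by (auto simp: W)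
  have "finite W" by (simp add: W_def)
  \<comment> \<open>Decodes the trace numbers: below 6 the inputs, \<open>6 + 4 * n\<close> the
    rules, \<open>8 + 4 * i\<close> the variables.\<close>
  define E where "E x = (if x < 6 then {g K (?\<nu> (x div 2))}
     else if x mod 4 = 2 then {g r 0 | r. r < K \<and> fst (ds ! r) = (x - 6) div 4}
     else {g r (\<sigma> r ((x - 8) div 4)) | r. r < K})" for x
  have E_input: "E (2 * a) = {g K (?\<nu> a)}" if "a < 3" for a using that by (simp add: E_def)
  have E0: "E 0 = {g K 0}" using E_input[of 0] by (simp add: input_val_def)
  have "(6 + 4 * n) mod 4 = 2" "(8 + 4 * n) mod 4 = 0" for n :: nat by presburger+
  then have E_rule: "E (6 + 4 * n) = {g r 0 | r. r < K \<and> fst (ds ! r) = n}"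
    and E_var: "E (8 + 4 * n) = {g r (\<sigma> r n) | r. r < K}" for n by (auto simp: E_def)
  \<comment> \<open>What \<open>now_or_lt1\<close> sees from the start of a row is exactly that
    row.\<close>
  have window: "g r 0 \<le> g r' c \<and> g r' c < g r 0 + 1 \<longleftrightarrow> r' = r" if "c < N" for r r' c
    using that N0 by (auto simp: Suc_g less le)
  have last_row: "sem W (interleave E C) t last_row" for C t
    using N0 by (auto simp: last_row_def E0 W Suc_g le)
  have unique: "sem W (interleave E C) t (input_unique a)" if "a < 3" for C t a
    using E_input[OF that] by (auto simp: input_unique_def)
  have grid: "sem W (interleave E C) t grid" if "t \<in> W" for C t
  proof -
    have "t + 1 \<in> W" if "t < g K 0"
    proof -
      obtain r c where rc: "c < N" "t = g r c" using \<open>t \<in> W\<close> by (auto simp: W)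
      with that N0 have "r < K" by (simp add: less)
      then show ?thesis using rc gW[of "Suc r" c] by (simp add: Suc_g)
    qed
    then show ?thesis by (auto simp: grid_def E0 intro!: bexI[of _ "t + 1"])
  qed
  have rule: "sem W (interleave E C) t (rule_row P m n)" if t: "t \<in> W" and n: "n < length P" for C t n
    unfolding sem_rule_row[OF t]
  proof (intro impI conjI ballI)
    assume "t \<in> E (6 + 4 * n)"
    then obtain r where r: "r < K" "fst (ds ! r) = n" and tr: "t = g r 0" by (auto simp: E_rule)
    fix i assume "i \<in> {..<m}"
    then show "\<exists>t' \<in> W. t \<le> t' \<and> t' < t + 1 \<and> t' \<in> E (8 + 4 * i)"
      using r \<sigma>N[of r i] window[of "\<sigma> r i" r r] unfolding tr
      by (intro bexI[of _ "g r (\<sigma> r i)"] gW) (auto simp: E_var)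
  next
    assume "t \<in> E (6 + 4 * n)"
    then obtain r where r: "r < K" "fst (ds ! r) = n" and tr: "t = g r 0" by (auto simp: E_rule)
    have R: "P ! n \<in> set P" using n by simp
    assume cols: "\<forall>i \<in> {..<m}. sem W (interleave E C) t (column i)"
    \<comment> \<open>Whatever else the universal traces contain, the assumptions force into them
      the true columns from row \<open>r\<close> through the last row.\<close>
    have col: "g r' (\<sigma> r i) \<in> C (2 * i + 3)" if "i < m" "r \<le> r'" "r' \<le> K" for i r'
    proof -
      have "sem W (interleave E C) t (column i)" using cols that(1) by simp
      note col_i = this[unfolded sem_column[OF t]]
      show ?thesis using that(2,3)
      proof (induction r' rule: dec_induct)
        \<comment> \<open>Here each row has a single event for variable \<open>i\<close>, so the
          anchor of the column is that event.\<close>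
        case base
        obtain t' where t': "t \<le> t'" "t' < t + 1" "t' \<in> C (2 * i + 3)" "t' \<in> E (8 + 4 * i)"
          using conjunct1[OF col_i] by blast
        then obtain r2 where r2: "r2 < K" "t' = g r2 (\<sigma> r2 i)" by (auto simp: E_var)
        have "r2 = r"
          using window[OF \<sigma>N[OF r2(1) that(1)], of r r2] t'(1,2) unfolding tr r2(2) by blast
        then show ?case using t'(3) r2(2) by simp
      next
        case (step r')
        let ?c = "g r' (\<sigma> r i)"
        have sN: "\<sigma> r i < N" using \<sigma>N r that(1) by simp
        have "?c \<in> W" "t \<le> ?c" using step sN N0 by (auto intro: gW simp: tr le)
        moreover have "?c \<in> C (2 * i + 3)" using step by simp
        moreover have "\<exists>s \<in> W. ?c < s \<and> s \<in> E 0"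
          using step N0 sN by (intro bexI[of _ "g K 0"] gW) (auto simp: E0 less)
        ultimately have "\<not> (\<exists>s \<in> W. ?c < s \<and> s < ?c + 1 \<and> s \<in> C (2 * i + 3))"
          "\<exists>s \<in> W. ?c < s \<and> s \<le> ?c + 1 \<and> s \<in> C (2 * i + 3)"
          using conjunct2[OF col_i, THEN bspec, of ?c] by blast+
        then have "?c + 1 \<in> C (2 * i + 3)" by (metis order_le_less)
        then show ?case by (simp add: Suc_g)
      qed
    qed
    have ok: "instance_ok P ?\<nu> (ds ! r) (drop (Suc r) ds)"
      using justified_nth[OF just] r by (simp add: K_def)
    have last_after: "g K 0 \<in> W" "t < g K 0" "g K 0 \<in> E 0"
      using r N0 by (auto intro: gW simp: E0 tr less)
    show "sem W (interleave E C) t (conj (premise_formulas P (P ! n)))"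
      unfolding sem_premises
    proof (intro conjI ballI; clarify)
      fix a i assume ai: "(a, i) \<in> set (inputs (P ! n))"
      then have "a < 3" "i < m" using bounded[OF R] by (auto simp: rule_bounded_def)
      have "\<sigma> r i = ?\<nu> a" using ok ai r by (auto simp: instance_ok_def \<sigma>_def)
      then have "g K (?\<nu> a) \<in> C (2 * i + 3)" using col[OF \<open>i < m\<close>, of K] r by simp
      then have "\<exists>t' \<in> W. g K 0 \<le> t' \<and> t' < g K 0 + 1 \<and> t' \<in> C (2 * i + 3) \<and> t' \<in> E (2 * a)"
        using window[OF \<nu>N, of K K a] \<nu>N E_input[OF \<open>a < 3\<close>]
        by (intro bexI[of _ "g K (?\<nu> a)"] gW) auto
      then show "sem W (interleave E C) t (ev (And (tr_input 0) (now_or_lt1 (And (tr_col i) (tr_input a)))))"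
        unfolding sem_input_premise using last_after by blast
    next
      fix i j assume ij: "(i, j) \<in> set (succs (P ! n))"
      then have ijm: "i < m" "j < m" using bounded[OF R] by (auto simp: rule_bounded_def)
      have sj: "\<sigma> r j = Suc (\<sigma> r i)" using ok ij r by (auto simp: instance_ok_def \<sigma>_def)
      have N2: "\<sigma> r i < N" "\<sigma> r j < N" using \<sigma>N r ijm by auto
      have "\<forall>w \<in> W. g K (\<sigma> r i) < w \<longrightarrow> g K (\<sigma> r j) \<le> w"
        using N2 sj by (auto simp: W less le)
      moreover have "g K (\<sigma> r i) < g K (\<sigma> r j)" using N2 sj by (simp add: less)
      moreover have "g K (\<sigma> r i) \<in> C (2 * i + 3)" "g K (\<sigma> r j) \<in> C (2 * j + 3)"
        using col ijm r by auto
      moreover have "g K 0 \<le> g K (\<sigma> r i)" "g K (\<sigma> r i) < g K 0 + 1"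
        using window[OF N2(1), of K K] by auto
      moreover have "g K (\<sigma> r i) \<in> W" "g K (\<sigma> r j) \<in> W" using N2 by (auto intro: gW)
      ultimately show "sem W (interleave E C) t
          (ev (And (tr_input 0) (now_or_lt1 (And (tr_col i) (nxt (tr_col j))))))"
        unfolding sem_succ_premise using last_after by blast
    next
      fix q zs assume qzs: "(q, zs) \<in> set (body (P ! n))"
      then obtain d' where "d' \<in> set (drop (Suc r) ds)" and pr: "proves P d' q (map (\<sigma> r) zs)"
        using ok r by (fastforce simp: instance_ok_def \<sigma>_def)
      then obtain i where "i < length (drop (Suc r) ds)" "drop (Suc r) ds ! i = d'"
        by (auto simp: in_set_conv_nth)
      then obtain r' where r': "r < r'" "r' < K" "d' = ds ! r'"
        by (intro that[of "Suc r + i"]) (auto simp: K_def)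
      let ?n' = "fst (ds ! r')" and ?hs = "head_args (P ! fst (ds ! r'))"
      have hs: "map (\<sigma> r') ?hs = map (\<sigma> r) zs" "?n' < length P" "head_sym (P ! ?n') = q"
        using pr r' by (auto simp: proves_def \<sigma>_def)
      have len: "length ?hs = length zs" using hs(1) by (metis length_map)
      have zm: "set zs \<subseteq> {..<m}" using bounded[OF R] qzs by (auto simp: rule_bounded_def)
      have hm: "set ?hs \<subseteq> {..<m}" using bounded[of "P ! ?n'"] hs(2) by (auto simp: rule_bounded_def)
      have W': "g r' 0 \<in> W" using r' N0 by (intro gW) auto
      have "sem W (interleave E C) (g r' 0) (fact_row P (q, zs) ?n')"
        unfolding sem_fact_row[OF W']
      proof (intro conjI ballI)
        show "g r' 0 \<in> E (6 + 4 * ?n')" using r' by (auto simp: E_rule)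
        fix h assume h: "h \<in> set ?hs"
        have "g r' (\<sigma> r' h) \<in> C (2 * z + 3)" if "(z, h) \<in> set (zip zs ?hs)" for z
        proof -
          have "\<sigma> r' h = \<sigma> r z"
            using that hs(1) len by (auto simp: set_zip list_eq_iff_nth_eq)
          moreover have "z < m" using zm that by (auto dest: set_zip_leftD)
          ultimately show ?thesis using col[of z r'] r' by simp
        qed
        moreover have "\<sigma> r' h < N" using \<sigma>N r' hm h by auto
        ultimately show "\<exists>t' \<in> W. g r' 0 \<le> t' \<and> t' < g r' 0 + 1 \<and> t' \<in> E (8 + 4 * h) \<and>
            (\<forall>z. (z, h) \<in> set (zip (snd (q, zs)) ?hs) \<longrightarrow> t' \<in> C (2 * z + 3))"
          using r' window[of "\<sigma> r' h" r' r'] E_var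
          by (intro bexI[of _ "g r' (\<sigma> r' h)"] gW) auto
      qed
      moreover have "?n' \<in> set (matching P (q, zs))" using hs len by (simp add: matching_def)
      moreover have "t < g r' 0" using r' N0 by (simp add: tr less)
      ultimately show "sem W (interleave E C) t (ev (disj (map (fact_row P (q, zs)) (matching P (q, zs)))))"
        unfolding sem_body_premise using W' by blast
    qed
  qed
  have input: "sem W (interleave E C) 0 (input_formula (?\<nu> a) a)" if "a < 3" for C a
  proof -
    have "{w \<in> W. g K 0 \<le> w \<and> w < g K (?\<nu> a)} = g K ` {..<?\<nu> a}"
    proof (intro equalityI subsetI)
      fix w assume "w \<in> {w \<in> W. g K 0 \<le> w \<and> w < g K (?\<nu> a)}"
      then show "w \<in> g K ` {..<?\<nu> a}"
        using \<nu>N[of a] N0 by (auto simp: W less le)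
    next
      fix w assume "w \<in> g K ` {..<?\<nu> a}"
      then obtain c where "c < ?\<nu> a" "w = g K c" by auto
      then show "w \<in> {w \<in> W. g K 0 \<le> w \<and> w < g K (?\<nu> a)}"
        using \<nu>N[of a] N0 gW[of K c] by (simp add: less le)
    qed
    moreover have "inj_on (g K) {..<?\<nu> a}"
      using \<nu>N[of a] by (auto simp: inj_on_def eq)
    ultimately have "card {w \<in> W. g K 0 \<le> w \<and> w < g K (?\<nu> a)} = ?\<nu> a"
      by (simp add: card_image)
    then have "sem W (interleave E C) (g K 0) (nth_next (?\<nu> a) (tr_input a))"
      using \<nu>N[of a] N0 gW E_input[OF that] sem_nth_next[OF \<open>finite W\<close>, of "g K 0"]
      by (auto simp: le intro!: bexI[of _ "g K (?\<nu> a)"])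
    then show ?thesis using gW[of K 0] N0 pos by (auto simp: input_formula_def E0)
  qed
  obtain r0 where r0: "r0 < K" "fst (ds ! r0) = 0"
    using goal by (auto simp: in_set_conv_nth K_def)
  then have "g r0 0 \<in> E (6 + 4 * 0)" unfolding E_rule by blast
  then have "\<exists>t \<in> W. 0 < t \<and> t \<in> E 6" using r0 N0 pos gW[of r0 0] by auto
  moreover have "\<exists>t \<in> W. 0 < t \<and> t \<in> E 0" using N0 pos gW[of K 0] by (auto simp: E0)
  ultimately have "sem W (interleave E C) 0 (program_formula P m)" for C
    using last_row grid unique rule by (auto simp: program_formula_def)
  then have "sem W (interleave E C) 0 (encoding (program_formula P m) n1 n2)" for C
    using input[of 1] input[of 2] by (simp add: encoding_def input_val_def)
  moreover have "W \<subseteq> {0..}" using less_imp_le[OF pos] by (auto simp: W)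
  ultimately show ?thesis using that \<open>finite W\<close> by blast
qed

end

section \<open>Diagonalisation\<close>

text \<open>\<open>Goal\<close> has no arguments, so deriving it says only that \<open>D\<close> has
  some value on inputs 1 and 2. Its rule comes first because \<open>program_formula\<close> demands
  a row for rule 0.\<close>

definition halting_program :: "recf \<Rightarrow> sym rule list" where
  "halting_program D = Rule Goal [] [(1, 0), (2, 1)] [] [(Fn D, [0, 1, 2])] # horn D 2"

lemma derivable_Goal_iff:
  "(\<exists>ws. derivable (halting_program D) (input_val n1 n2) Goal ws) \<longleftrightarrow>
   (\<exists>v. rec_eval D [n1, n2] = Some v)"
proof
  let ?halts = "\<exists>v. rec_eval D [n1, n2] = Some v"
  assume "\<exists>ws. derivable (halting_program D) (input_val n1 n2) Goal ws"
  then obtain ws where "derivable (halting_program D) (input_val n1 n2) Goal ws" by blast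
  then have "sym_true ?halts Goal ws"
  proof (rule derivable_sound)
    fix R \<sigma>
    assume R: "R \<in> set (halting_program D)"
      "\<forall>(a, i) \<in> set (inputs R). \<sigma> i = input_val n1 n2 a"
      "\<forall>(i, j) \<in> set (succs R). \<sigma> j = Suc (\<sigma> i)"
      "\<forall>(q, zs) \<in> set (body R). sym_true ?halts q (map \<sigma> zs)"
    show "sym_true ?halts (head_sym R) (map \<sigma> (head_args R))"
    proof (cases "R \<in> set (horn D 2)")
      case True
      then show ?thesis using R(2-) by (intro horn_sound) (auto simp: input_val_def)
    next
      case False
      then have "R = Rule Goal [] [(1, 0), (2, 1)] [] [(Fn D, [0, 1, 2])]"
        using R(1) by (simp add: halting_program_def)
      then show ?thesis using R(2-) by (auto simp: input_val_def)
    qed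
  qed
  then show ?halts by simp
next
  assume "\<exists>v. rec_eval D [n1, n2] = Some v"
  then obtain v where v: "rec_eval D [n1, n2] = Some v" by blast
  have "derivable (halting_program D) (input_val n1 n2) (Fn D) ([n1, n2] @ [v])"
    using v by (rule horn_complete) (auto simp: halting_program_def input_val_def numeral_2_eq_2)
  then have "derivable (halting_program D) (input_val n1 n2) Goal []"
    by (intro derivable_ruleI[where \<sigma> = "(!) [n1, n2, v]" and R = "hd (halting_program D)"])
      (auto simp: halting_program_def input_val_def)
  then show "\<exists>ws. derivable (halting_program D) (input_val n1 n2) Goal ws" by blast
qed

definition rule_vars :: "sym rule \<Rightarrow> nat set" where
  "rule_vars R = set (head_args R) \<union> snd ` set (inputs R) \<union> fst ` set (succs R) \<union> snd ` set (succs R)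
     \<union> (\<Union>f \<in> set (body R). set (snd f))"

lemma halting_program_bounded:
  obtains m where "\<And>R. R \<in> set (halting_program D) \<Longrightarrow> rule_bounded m R"
proof -
  have "finite (\<Union>R \<in> set (halting_program D). rule_vars R)" by (simp add: rule_vars_def)
  then obtain m where m: "\<forall>i \<in> (\<Union>R \<in> set (halting_program D). rule_vars R). i < m"
    unfolding finite_nat_set_iff_bounded by blast
  have inp: "a < 3" if "R \<in> set (halting_program D)" "(a, i) \<in> set (inputs R)" for R a i
    using that horn_inputs[of R D 2 a i] by (auto simp: halting_program_def)
  have "rule_bounded m R" if "R \<in> set (halting_program D)" for R
  proof -
    have "rule_vars R \<subseteq> {..<m}" using m that by auto
    then have "set (head_args R) \<subseteq> {..<m}" "\<forall>x \<in> set (inputs R). snd x < m"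
      "\<forall>x \<in> set (succs R). fst x < m \<and> snd x < m" "\<forall>x \<in> set (body R). set (snd x) \<subseteq> {..<m}"
      by (auto simp: rule_vars_def)
    then show ?thesis using inp[OF that] unfolding rule_bounded_def by fastforce
  qed
  then show ?thesis using that by blast
qed

lemma encoding_satisfiable_iff:
  assumes bounded: "\<And>R. R \<in> set (halting_program D) \<Longrightarrow> rule_bounded m R"
  shows "(\<exists>W. finite W \<and> W \<subseteq> {0..} \<and> (\<exists>E. \<forall>C. sem W (interleave E C) 0
     (encoding p (program_formula p (halting_program D) m) n1 n2))) \<longleftrightarrow>
   (\<exists>v. rec_eval D [n1, n2] = Some v)"
  unfolding derivable_Goal_iff[symmetric]
proof
  let ?P = "halting_program D"
  assume "\<exists>W. finite W \<and> W \<subseteq> {0..} \<and> (\<exists>E. \<forall>C. sem W (interleave E C) 0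
     (encoding p (program_formula p ?P m) n1 n2))"
  then obtain W E where "finite W"
    "\<And>C. sem W (interleave E C) 0 (encoding p (program_formula p ?P m) n1 n2)" by blast
  then have "\<exists>ws. derivable ?P (input_val n1 n2) (head_sym (?P ! 0)) ws"
    by (intro encoding_sound[where p = p]) (auto simp: halting_program_def bounded[unfolded halting_program_def])
  then show "\<exists>ws. derivable ?P (input_val n1 n2) Goal ws" by (simp add: halting_program_def)
next
  let ?P = "halting_program D"
  assume "\<exists>ws. derivable ?P (input_val n1 n2) Goal ws"
  then obtain ds d ws where ds: "justified ?P (input_val n1 n2) ds" "d \<in> set ds" "proves ?P d Goal ws"
    using justified_if_derivable by blast
  \<comment> \<open>An instance proving \<open>Goal\<close> must use the first rule, which supplies
    the row demanded for rule 0.\<close>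
  have "fst d = 0"
  proof (rule ccontr)
    assume "fst d \<noteq> 0"
    then have "?P ! fst d \<in> set (horn D 2)"
      using ds(3) by (auto simp: proves_def halting_program_def nth_Cons split: nat.splits)
    then show False using horn_head ds(3) by (auto simp: proves_def)
  qed
  then show "\<exists>W. finite W \<and> W \<subseteq> {0..} \<and> (\<exists>E. \<forall>C. sem W (interleave E C) 0
     (encoding p (program_formula p ?P m) n1 n2))"
    using encoding_complete[OF bounded ds(1,2)] by metis
qed

section \<open>An automaton accepting all timed words\<close>

definition all_words :: "nat set \<Rightarrow> (nat set, nat, nat) ta" where
  "all_words AP = \<lparr>locs = {0}, init = 0, clocks = {},
     trans = (\<lambda>a. (0, a, GTrue, {}, 0)) ` Pow AP, final = {0}\<rparr>"

lemma timed_automaton_all_words: "finite AP \<Longrightarrow> timed_automaton (Pow AP) (all_words AP)"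
  by (auto simp: timed_automaton_def all_words_def)

lemma ta_lang_all_words: "ta_lang (Pow AP) (all_words AP) = timed_words (Pow AP)"
proof -
  have "\<exists>s v. is_run (all_words AP) \<rho> s v \<and> s (length \<rho>) \<in> final (all_words AP)"
    if "\<rho> \<in> timed_words (Pow AP)" for \<rho>
  proof -
    \<comment> \<open>\<open>is_run\<close> also updates clock names outside \<open>clocks\<close>;
      without resets each of them shows the time elapsed.\<close>
    define v where "v i = (\<lambda>x :: nat. if i = 0 then 0 else snd (\<rho> ! (i - 1)))" for i
    have "fst (\<rho> ! i) \<subseteq> AP" if "i < length \<rho>" for i
      using \<open>\<rho> \<in> timed_words (Pow AP)\<close> nth_mem[OF that] by (fastforce simp: timed_words_def)
    then have "is_run (all_words AP) \<rho> (\<lambda>_. 0) v"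
      unfolding is_run_def
      by (auto simp: all_words_def v_def Let_def intro!: exI[of _ GTrue] exI[of _ "{}"])
    then show ?thesis by (intro exI[of _ "\<lambda>_. 0"]) (auto simp: all_words_def)
  qed
  then show ?thesis by (auto simp: ta_lang_def)
qed

section \<open>Computability of the reduction on codes\<close>

definition rquantify :: "nat \<Rightarrow> nat \<Rightarrow> recf" where
  "rquantify q b = PrimRec (Proj 0)
     (rlist [rconst q, Comp radd [Comp radd [Proj 0, Proj 0], rconst b], Proj 1])"

lemma rec_eval_PrimRec_Suc:
  "rec_eval (PrimRec f g) (n # xs) = Some v \<Longrightarrow>
   rec_eval (PrimRec f g) (Suc n # xs) = rec_eval g (n # v # xs)"
  by simp

lemma rec_eval_rquantify:
  assumes "\<And>x \<phi>. hypermtl_code (Q x \<phi>) = list_encode [q, x, hypermtl_code \<phi>]"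
  shows "rec_eval (rquantify q b) [k, hypermtl_code \<phi>] = Some (hypermtl_code (quantify Q b k \<phi>))"
proof (induction k)
  case 0
  show ?case by (simp add: rquantify_def)
next
  case (Suc k)
  show ?case
    unfolding rquantify_def
    by (subst rec_eval_PrimRec_Suc[OF Suc[unfolded rquantify_def]])
      (simp only: quantify.simps assms, intro rec_eval_rlist, simp)
qed

definition rnth_next :: "mtl \<Rightarrow> recf" where
  "rnth_next \<psi> = PrimRec (rconst (mtl_code \<psi>))
     (rlist [rconst 5, rconst (mtl_code (Neg Top)), rconst (intvl_code (Unbnd False 0)), Proj 1])"

lemma rec_eval_rnth_next: "rec_eval (rnth_next \<psi>) [n] = Some (mtl_code (nth_next n \<psi>))"
proof (induction n)
  case 0
  show ?case by (simp add: rnth_next_def)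
next
  case (Suc n)
  show ?case
    unfolding rnth_next_def
    by (subst rec_eval_PrimRec_Suc[OF Suc[unfolded rnth_next_def]])
      (simp only: nth_next.simps nxt_def mtl_code.simps(6), intro rec_eval_rlist, simp)
qed

definition rinput :: "nat \<Rightarrow> nat \<Rightarrow> recf \<Rightarrow> recf" where
  "rinput p a f = rlist [rconst 5, rconst (mtl_code Top), rconst (intvl_code (Unbnd False 0)),
     rlist [rconst 3, rconst (mtl_code (tr_input p 0)), Comp (rnth_next (tr_input p a)) [f]]]"

lemma rec_eval_rinput:
  assumes "rec_eval f xs = Some n"
  shows "rec_eval (rinput p a f) xs = Some (mtl_code (input_formula p n a))"
  unfolding rinput_def input_formula_def ev_def eventually_in_def mtl_code.simps(4,6)
  by (intro rec_eval_rlist list.rel_intros rec_eval_rconst) (simp add: assms rec_eval_rnth_next)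

definition rencoding :: "nat \<Rightarrow> recf" where
  "rencoding p = rlist [rconst 3, Proj 1, rlist [rconst 3, rinput p 1 (Proj 0), rinput p 2 (Proj 1)]]"

lemma rec_eval_rencoding:
  "rec_eval (rencoding p) [k, mtl_code \<psi>] = Some (mtl_code (encoding p \<psi> k (mtl_code \<psi>)))"
  unfolding rencoding_def encoding_def mtl_code.simps(4)
  by (intro rec_eval_rlist list.rel_intros rec_eval_rconst rec_eval_rinput) simp_all

text \<open>The automaton enters as a constant. The matrix enters only through its code, which
  serves twice: as a subformula and as the numeral fed to the program.\<close>

lemma reduction_exall_computable:
  obtains c where "\<And>k \<psi>. rec_eval c [k, mtl_code \<psi>] =
    Some (mc_code (A, exall k (encoding p \<psi> k (mtl_code \<psi>))))"
proof
  fix k \<psi>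
  let ?c = "Comp (rquantify 0 0) [Proj 0, Comp (rquantify 1 1) [Proj 0, rlist [rconst 2, rencoding p]]]"
  have "rec_eval (rlist [rconst 2, rencoding p]) [k, mtl_code \<psi>] =
      Some (hypermtl_code (QF (encoding p \<psi> k (mtl_code \<psi>))))"
    unfolding hypermtl_code.simps
    by (intro rec_eval_rlist list.rel_intros rec_eval_rconst rec_eval_rencoding)
  then have "rec_eval ?c [k, mtl_code \<psi>] =
      Some (hypermtl_code (exall k (encoding p \<psi> k (mtl_code \<psi>))))"
    unfolding exall_def
    by (simp add: rec_eval_rquantify[of All] rec_eval_rquantify[of Ex] del: hypermtl_code.simps(3) list_encode.simps)
  then show "rec_eval (rlist [rconst (ta_code A), ?c]) [k, mtl_code \<psi>] =
      Some (mc_code (A, exall k (encoding p \<psi> k (mtl_code \<psi>))))"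
    unfolding mc_code.simps
    by (intro rec_eval_rlist list.rel_intros rec_eval_rconst)
qed

lemma reduction_allex_computable:
  obtains c where "\<And>k \<psi>. rec_eval c [k, mtl_code \<psi>] =
    Some (mc_code (A, allex k (Neg (encoding p \<psi> k (mtl_code \<psi>)))))"
proof
  fix k \<psi>
  let ?c = "Comp (rquantify 1 0) [Proj 0, Comp (rquantify 0 1) [Proj 0,
    rlist [rconst 2, rlist [rconst 4, rencoding p]]]]"
  have "rec_eval (rlist [rconst 2, rlist [rconst 4, rencoding p]]) [k, mtl_code \<psi>] =
      Some (hypermtl_code (QF (Neg (encoding p \<psi> k (mtl_code \<psi>)))))"
    unfolding hypermtl_code.simps mtl_code.simps(5)
    by (intro rec_eval_rlist list.rel_intros rec_eval_rconst rec_eval_rencoding)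
  then have "rec_eval ?c [k, mtl_code \<psi>] =
      Some (hypermtl_code (allex k (Neg (encoding p \<psi> k (mtl_code \<psi>)))))"
    unfolding allex_def
    by (simp add: rec_eval_rquantify[of All] rec_eval_rquantify[of Ex] del: hypermtl_code.simps(3) list_encode.simps)
  then show "rec_eval (rlist [rconst (ta_code A), ?c]) [k, mtl_code \<psi>] =
      Some (mc_code (A, allex k (Neg (encoding p \<psi> k (mtl_code \<psi>)))))"
    unfolding mc_code.simps
    by (intro rec_eval_rlist list.rel_intros rec_eval_rconst)
qed

section \<open>Syntactic side conditions\<close>

lemma mtl_vars_encoding: "mtl_vars (encoding p \<psi> n1 n2) = mtl_vars \<psi> \<union> {0, 2, 4}"
proof -
  have "mtl_vars (nth_next n \<psi>) = mtl_vars \<psi>" for n \<psi> by (induction n) (auto simp: nxt_def)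
  then show ?thesis
    by (auto simp: encoding_def input_formula_def ev_def eventually_in_def tr_input_def)
qed

lemmas operator_defs = eventually_in_def ev_def ev_lt1_def ev_le1_def ev_ge1_def nxt_def alw_def
  imp_def now_or_lt1_def disj_def

lemmas trace_defs = tr_input_def tr_rule_def tr_var_def tr_mark_def tr_col_def

lemma mtl_over_conj: "mtl_over A (conj \<psi>s) \<longleftrightarrow> (\<forall>\<psi> \<in> set \<psi>s. mtl_over A \<psi>)"
  by (induction \<psi>s) (auto simp: imp_def)

lemma mtl_over_program_formula: "mtl_over {p} (program_formula p P m)"
  by (auto simp: program_formula_def last_row_def grid_def input_unique_def rule_row_def
      column_def col_step_def premise_formulas_def fact_row_def operator_defs trace_defs mtl_over_conj)

lemma mtl_over_encoding: "mtl_over {p} \<psi> \<Longrightarrow> mtl_over {p} (encoding p \<psi> n1 n2)"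
proof -
  have "mtl_over {p} (nth_next n \<psi>) = mtl_over {p} \<psi>" for n \<psi> by (induction n) (auto simp: nxt_def)
  then show "mtl_over {p} \<psi> \<Longrightarrow> ?thesis"
    by (auto simp: encoding_def input_formula_def ev_def eventually_in_def tr_input_def)
qed

lemma temporal_encoding: "temporal \<psi> \<Longrightarrow> temporal (encoding p \<psi> n1 n2)"
  by (simp add: encoding_def input_formula_def ev_def eventually_in_def)

lemma temporal_program_formula: "temporal (program_formula p P m)"
  by (simp add: program_formula_def alw_def ev_def eventually_in_def)

lemma finite_mtl_vars: "finite (mtl_vars \<psi>)"
  by (induction \<psi>) auto

definition admissible :: "nat \<Rightarrow> nat \<Rightarrow> mtl \<Rightarrow> bool" where
  "admissible p k \<psi> \<longleftrightarrow> mtl_over {p} \<psi> \<and> temporal \<psi> \<and> mtl_vars \<psi> \<subseteq> {..<k + k} \<and> 0 < k"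

text \<open>Both the numbers describing the formula for \<open>D\<close>, the length \<open>k\<close> of its quantifier blocks and the
  code of its matrix, are fed to \<open>D\<close>.\<close>

lemma diagonalisation:
  assumes p: "p \<in> AP"
    and h: "\<And>k \<psi>. admissible p k (encoding p \<psi> k (mtl_code \<psi>)) \<Longrightarrow> rec_eval h [k, mtl_code \<psi>] =
      Some (if sync_models (timed_words (Pow AP)) (exall k (encoding p \<psi> k (mtl_code \<psi>))) then 1 else 0)"
  shows False
proof -
  \<comment> \<open>Every candidate of the search yields the same call of \<open>h\<close>, so the
    search stops at once if \<open>h\<close> answers 0 and never otherwise.\<close>
  define D where "D = Minim (Comp h [Proj 1, Proj 2])"
  obtain m where m: "\<And>R. R \<in> set (halting_program D) \<Longrightarrow> rule_bounded m R"
    using halting_program_bounded by blast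
  define \<psi> where "\<psi> = program_formula p (halting_program D) m"
  obtain k0 where k0: "\<forall>x \<in> mtl_vars \<psi>. x < k0"
    using finite_mtl_vars finite_nat_set_iff_bounded by blast
  \<comment> \<open>Long enough for the variables of the matrix and for the input traces 0, 2 and 4.
    The matrix is fixed before \<open>k\<close>, which enters only through the numerals and the
    quantifier blocks.\<close>
  define k where "k = k0 + 5"
  let ?e = "encoding p \<psi> k (mtl_code \<psi>)"
  have adm: "admissible p k ?e"
    using k0 unfolding admissible_def mtl_vars_encoding k_def
    by (auto simp: \<psi>_def mtl_over_encoding mtl_over_program_formula temporal_encoding temporal_program_formula)
  have "sync_models (timed_words (Pow AP)) (exall k ?e) \<longleftrightarrow>
      (\<exists>v. rec_eval D [k, mtl_code \<psi>] = Some v)"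
    using adm unfolding \<psi>_def admissible_def
    by (intro trans[OF sync_models_exall[OF p] encoding_satisfiable_iff[OF m]]) auto
  moreover have "(\<exists>v. rec_eval D [k, mtl_code \<psi>] = Some v) \<longleftrightarrow> rec_eval h [k, mtl_code \<psi>] = Some 0"
    by (auto simp: D_def)
  ultimately show False using h[OF adm] by auto
qed

theorem theorem4:
  fixes AP :: "nat set"
  assumes "finite AP" and "AP \<noteq> {}"
  shows "\<not> sync_mc_decidable AP exists_forall \<and> \<not> sync_mc_decidable AP forall_exists"
proof -
  obtain p where p: "p \<in> AP" using assms(2) by blast
  let ?A = "all_words AP" and ?T = "timed_words (Pow AP)"
  have "False" if dec: "sync_mc_decidable AP exists_forall"
  proof -
    obtain f where f: "\<And>\<phi>. closed_hypermtl AP \<phi> \<Longrightarrow> exists_forall \<phi> \<Longrightarrow>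
        rec_eval f [mc_code (?A, \<phi>)] = Some (if sync_models ?T \<phi> then 1 else 0)"
      using dec timed_automaton_all_words[OF assms(1)] ta_lang_all_words
      unfolding sync_mc_decidable_def decidable_def mc_instances_def by fastforce
    obtain c where c: "\<And>k \<psi>. rec_eval c [k, mtl_code \<psi>] =
        Some (mc_code (?A, exall k (encoding p \<psi> k (mtl_code \<psi>))))"
      using reduction_exall_computable by blast
    show False
    proof (rule diagonalisation[OF p])
      fix k \<psi> assume "admissible p k (encoding p \<psi> k (mtl_code \<psi>))"
      then show "rec_eval (Comp f [c]) [k, mtl_code \<psi>] =
        Some (if sync_models ?T (exall k (encoding p \<psi> k (mtl_code \<psi>))) then 1 else 0)"
        using f[OF closed_exall(1)[OF p] exists_forall_exall]
        by (simp add: c admissible_def del: mc_code.simps)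
    qed
  qed
  moreover have "False" if dec: "sync_mc_decidable AP forall_exists"
  proof -
    obtain f where f: "\<And>\<phi>. closed_hypermtl AP \<phi> \<Longrightarrow> forall_exists \<phi> \<Longrightarrow>
        rec_eval f [mc_code (?A, \<phi>)] = Some (if sync_models ?T \<phi> then 1 else 0)"
      using dec timed_automaton_all_words[OF assms(1)] ta_lang_all_words
      unfolding sync_mc_decidable_def decidable_def mc_instances_def by fastforce
    obtain c where c: "\<And>k \<psi>. rec_eval c [k, mtl_code \<psi>] =
        Some (mc_code (?A, allex k (Neg (encoding p \<psi> k (mtl_code \<psi>)))))"
      using reduction_allex_computable by blast
    show False
    proof (rule diagonalisation[OF p])
      fix k \<psi> assume adm: "admissible p k (encoding p \<psi> k (mtl_code \<psi>))"
      let ?e = "encoding p \<psi> k (mtl_code \<psi>)"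
      have "sync_models ?T (allex k (Neg ?e)) \<longleftrightarrow> \<not> sync_models ?T (exall k ?e)"
        using adm p by (intro sync_models_allex) (auto simp: admissible_def)
      moreover have "closed_hypermtl AP (allex k (Neg ?e))"
        using adm by (intro closed_exall(2)[OF p]) (auto simp: admissible_def)
      \<comment> \<open>The decider judges the negated formula, so its answers 0 and 1 are
        exchanged.\<close>
      ultimately show "rec_eval (Comp riszero [Comp f [c]]) [k, mtl_code \<psi>] =
          Some (if sync_models ?T (exall k ?e) then 1 else 0)"
        using f[OF _ forall_exists_allex] by (simp add: c del: mc_code.simps)
    qed
  qed
  ultimately show ?thesis by blast
qed

end
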